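(* Let $\ell>1$ be an integer, let $m,n$ be coprime positive integers, and let $L=T(\ell n,\ell m)\subset S^3$ be the oriented ordered $\ell$-component torus link with its canonical meridional coefficient system. Put $U=t_1\cdots t_\ell$, $$D(U)=U^{mn}-1,\quad A(U)=\frac{D(U)}{U^m-1},\quad B(U)=\frac{D(U)}{U^n-1},\quad \Theta(U)=A(U)B(U),$$ $$P_k(U):=D(U)^{\ell-1-k}\,\Theta(U)\quad(1\le k<\ell),\qquad P_\ell(U):=\gcd\bigl(A(U),B(U)\bigr)=\frac{D(U)(U-1)}{(U^m-1)(U^n-1)}.$$ With respect to the lexicographic order $t_1>\cdots>t_\ell$, $$\mathrm{AG}_k(L)=\begin{cases}\bigl\{P_k(U)(t_i-1)\mid 1\le i\le\ell\bigr\},&1\le k<\ell,\\ \{P_\ell(U)\},&k=\ell.\end{cases}$$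
   Context: Put $\Lambda=\mathbb Q[t_1^{\pm1},\dots,t_\ell^{\pm1}]$ and $P=\mathbb Q[t_1,\dots,t_\ell]$. For a finitely presented group $G=\langle x_1,\dots,x_N\mid r_1,\dots,r_s\rangle$ with an epimorphism $\phi\colon G\to\mathbb Z^\ell$, let $\Phi\colon\mathbb Z[F_N]\to\Lambda$ be the induced ring map ($F_N$ the free group on the $x_j$, with the standard basis vector $e_i$ corresponding to $t_i$), and let $A_\phi=(\Phi(\partial r_i/\partial x_j))$ be the $s\times N$ Fox matrix. The $k$th elementary ideal $E_k(G,\phi)\subset\Lambda$ is the ideal generated by the $(N-k)\times(N-k)$ minors of $A_\phi$ (equal to $0$ if $N-k>\min(s,N)$, and $\Lambda$ if $N-k\le 0$); it is independent of the presentation. $\mathrm{AG}_k(G,\phi)$ denotes the reduced Gröbner basis of $E_k(G,\phi)\cap P$ with respect to the lexicographic order $t_1>\cdots>t_\ell$. For an oriented ordered link $L\subset S^3$ with $\ell$ components and exterior $X_L$, put $\mathrm{AG}_k(L)=\mathrm{AG}_k(\pi_1(X_L),\phi)$, where $\phi(\mu_i)=e_i$ for the positive meridian $\mu_i$ of the $i$th component. The torus link $T(\ell n,\ell m)$ consists of $\ell$ parallel, coherently oriented copies of the $(n,m)$ torus knot on a standard torus. The paper uses the following known description of $(\pi_1(X_L),\phi)$: $$\pi_1(X_L)\cong\langle\alpha,\beta,f_1,\dots,f_{\ell-1}\mid \alpha^n\beta^{-m},\ \alpha^n f_i\beta^{-m}f_i^{-1}\ (1\le i<\ell)\rangle,$$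 with $\phi(\alpha)=m(e_1+\cdots+e_\ell)$, $\phi(\beta)=n(e_1+\cdots+e_\ell)$, $\phi(f_i)=e_1+\cdots+e_i$. *)

theory Defs
  imports
    "HOL-Analysis.Analysis"
    "HOL-Algebra.Ideal"
    "HOL-Library.Poly_Mapping"
    "HOL-Computational_Algebra.Computational_Algebra"
    "HOL-Computational_Algebra.Field_as_Ring"
    "Jordan_Normal_Form.Determinant"
    "Jordan_Normal_Form.DL_Submatrix"
begin

section \<open>Laurent polynomials and lexicographic Groebner bases\<close>

text \<open>An exponent vector is a finitely supported function; the variables are
  \<open>t\<^sub>1, \<dots>, t\<^sub>l\<close>, indexed by \<open>{1..l}\<close>. The monoid ring \<open>laurent\<close> has infinitely many
  variables, so the rings in \<open>l\<close> variables are cut out as subrings.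
  The library order on \<open>exponent\<close> compares two vectors at the smallest index where they
  differ: this is the lexicographic order with \<open>t\<^sub>1 > \<dots> > t\<^sub>l\<close>.\<close>

type_synonym exponent = "nat \<Rightarrow>\<^sub>0 int"
type_synonym laurent = "exponent \<Rightarrow>\<^sub>0 rat"

definition Z_lattice :: "nat \<Rightarrow> exponent monoid" where
  "Z_lattice l = \<lparr>carrier = {e. Poly_Mapping.keys e \<subseteq> {1..l}}, monoid.mult = (+), one = 0\<rparr>"

definition basis_vec :: "nat \<Rightarrow> exponent" where
  "basis_vec i = Poly_Mapping.single i 1"

definition t_monom :: "exponent \<Rightarrow> laurent" where
  "t_monom e = Poly_Mapping.single e 1"

definition t_var :: "nat \<Rightarrow> laurent" where
  "t_var i = t_monom (basis_vec i)"

definition laurent_ring :: "nat \<Rightarrow> laurent ring" where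
  "laurent_ring l =
     \<lparr>carrier = {f. Poly_Mapping.keys f \<subseteq> carrier (Z_lattice l)},
      monoid.mult = (*), one = 1, ring.zero = 0, add = (+)\<rparr>"

definition polynomials :: "nat \<Rightarrow> laurent set" where
  "polynomials l =
     {f \<in> carrier (laurent_ring l).
        \<forall>e \<in> Poly_Mapping.keys f. \<forall>i. 0 \<le> Poly_Mapping.lookup e i}"

definition lead_monom :: "laurent \<Rightarrow> exponent" where
  "lead_monom f = Max (Poly_Mapping.keys f)"

definition monom_dvd :: "exponent \<Rightarrow> exponent \<Rightarrow> bool" where
  "monom_dvd d e \<longleftrightarrow> (\<forall>i. Poly_Mapping.lookup d i \<le> Poly_Mapping.lookup e i)"

definition reduced_groebner_basis :: "laurent set \<Rightarrow> laurent set \<Rightarrow> bool" where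
  "reduced_groebner_basis I B \<longleftrightarrow>
     finite B \<and> B \<subseteq> I \<and> 0 \<notin> B \<and>
     (\<forall>f \<in> I - {0}. \<exists>g \<in> B. monom_dvd (lead_monom g) (lead_monom f)) \<and>
     (\<forall>g \<in> B. Poly_Mapping.lookup g (lead_monom g) = 1) \<and>
     (\<forall>g \<in> B. \<forall>h \<in> B - {g}. \<forall>e \<in> Poly_Mapping.keys g. \<not> monom_dvd (lead_monom h) e)"

section \<open>Group presentations\<close>

text \<open>The letter \<open>(j, True)\<close> is the generator \<open>x\<^sub>j\<close> and \<open>(j, False)\<close> is its inverse.
  Elements of the free group are represented by not necessarily reduced words.
  Generators are numbered from 0.\<close>

type_synonym letter = "nat \<times> bool"
type_synonym word = "letter list"

definition words :: "nat \<Rightarrow> word set" where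
  "words N = {w. fst ` set w \<subseteq> {..<N}}"

definition letter_inv :: "letter \<Rightarrow> letter" where
  "letter_inv x = (fst x, \<not> snd x)"

definition word_inv :: "word \<Rightarrow> word" where
  "word_inv w = rev (map letter_inv w)"

text \<open>All words over \<open>N\<close> letters that represent an element of the normal closure of \<open>R\<close>
  in the free group.\<close>

inductive_set normal_closure :: "nat \<Rightarrow> word set \<Rightarrow> word set"
  for N :: nat and R :: "word set" where
  empty: "[] \<in> normal_closure N R"
| relator: "r \<in> R \<Longrightarrow> r \<in> normal_closure N R"
| inverse: "w \<in> normal_closure N R \<Longrightarrow> word_inv w \<in> normal_closure N R"
| product: "v \<in> normal_closure N R \<Longrightarrow> w \<in> normal_closure N R \<Longrightarrow> v @ w \<in> normal_closure N R"
| conjugate: "w \<in> normal_closure N R \<Longrightarrow> v \<in> words N \<Longrightarrow>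
    v @ w @ word_inv v \<in> normal_closure N R"
| cancel: "v @ [x, letter_inv x] @ w \<in> normal_closure N R \<Longrightarrow> v @ w \<in> normal_closure N R"
| insert: "v @ w \<in> normal_closure N R \<Longrightarrow> fst x < N \<Longrightarrow>
    v @ [x, letter_inv x] @ w \<in> normal_closure N R"

definition letter_value :: "('a, 'b) monoid_scheme \<Rightarrow> (nat \<Rightarrow> 'a) \<Rightarrow> letter \<Rightarrow> 'a" where
  "letter_value G g x = (if snd x then g (fst x) else inv\<^bsub>G\<^esub> (g (fst x)))"

definition word_value :: "('a, 'b) monoid_scheme \<Rightarrow> (nat \<Rightarrow> 'a) \<Rightarrow> word \<Rightarrow> 'a" where
  "word_value G g w = foldr (\<lambda>x y. letter_value G g x \<otimes>\<^bsub>G\<^esub> y) w \<one>\<^bsub>G\<^esub>"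

text \<open>\<open>G\<close> is presented by \<open>N\<close> generators with relators \<open>rs\<close>, the \<open>j\<close>th generator
  being the element \<open>g j\<close>.\<close>

definition presents ::
  "('a, 'b) monoid_scheme \<Rightarrow> nat \<Rightarrow> word list \<Rightarrow> (nat \<Rightarrow> 'a) \<Rightarrow> bool" where
  "presents G N rs g \<longleftrightarrow>
     group G \<and> set rs \<subseteq> words N \<and> g ` {..<N} \<subseteq> carrier G \<and>
     word_value G g ` words N = carrier G \<and>
     (\<forall>w \<in> words N. word_value G g w = \<one>\<^bsub>G\<^esub> \<longleftrightarrow> w \<in> normal_closure N (set rs))"

section \<open>Fox calculus and elementary ideals\<close>

text \<open>The derivative of a word with respect to \<open>x\<^sub>j\<close>, an element of the integral group ring
  of the free group, is returned as a list of signed words whose formal sum it is.\<close>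

fun fox :: "nat \<Rightarrow> word \<Rightarrow> (int \<times> word) list" where
  "fox j [] = []"
| "fox j ((i, s) # w) =
     (if i = j then (if s then [(1, [])] else [(- 1, [(i, False)])]) else []) @
     map (\<lambda>(c, v). (c, (i, s) # v)) (fox j w)"

definition induced_map ::
  "('a, 'b) monoid_scheme \<Rightarrow> ('a \<Rightarrow> exponent) \<Rightarrow> (nat \<Rightarrow> 'a) \<Rightarrow> (int \<times> word) list \<Rightarrow> laurent"
  where
  "induced_map G \<phi> g xs =
     sum_list (map (\<lambda>(c, v). of_int c * t_monom (\<phi> (word_value G g v))) xs)"

definition fox_matrix ::
  "('a, 'b) monoid_scheme \<Rightarrow> ('a \<Rightarrow> exponent) \<Rightarrow> nat \<Rightarrow> word list \<Rightarrow> (nat \<Rightarrow> 'a) \<Rightarrow> laurent mat"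
  where
  "fox_matrix G \<phi> N rs g =
     mat (length rs) N (\<lambda>(i, j). induced_map G \<phi> g (fox j (rs ! i)))"

definition minors :: "'r::comm_ring_1 mat \<Rightarrow> nat \<Rightarrow> 'r set" where
  "minors A d =
     {Determinant.det (submatrix A I J) | I J.
        I \<subseteq> {..<dim_row A} \<and> J \<subseteq> {..<dim_col A} \<and> card I = d \<and> card J = d}"

text \<open>If \<open>N - k\<close> exceeds the number of rows there are no minors and the ideal is zero. If
  \<open>N \<le> k\<close>, truncated subtraction yields the empty minor 1, hence the whole ring.
  The ideal does not depend on the chosen finite presentation.\<close>

definition elementary_ideal ::
  "nat \<Rightarrow> nat \<Rightarrow> ('a, 'b) monoid_scheme \<Rightarrow> ('a \<Rightarrow> exponent) \<Rightarrow> laurent set" where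
  "elementary_ideal l k G \<phi> =
     (let (N, rs, g) = (SOME (N, rs, g). presents G N rs g)
      in Idl\<^bsub>laurent_ring l\<^esub> (minors (fox_matrix G \<phi> N rs g) (N - k)))"

definition AG :: "nat \<Rightarrow> nat \<Rightarrow> ('a, 'b) monoid_scheme \<Rightarrow> ('a \<Rightarrow> exponent) \<Rightarrow> laurent set" where
  "AG l k G \<phi> = (THE B. reduced_groebner_basis (elementary_ideal l k G \<phi> \<inter> polynomials l) B)"

section \<open>Fundamental group\<close>

definition loops :: "'a::topological_space set \<Rightarrow> 'a \<Rightarrow> (real \<Rightarrow> 'a) set" where
  "loops X b = {p. path p \<and> path_image p \<subseteq> X \<and> pathstart p = b \<and> pathfinish p = b}"

definition loop_class :: "'a::topological_space set \<Rightarrow> (real \<Rightarrow> 'a) \<Rightarrow> (real \<Rightarrow> 'a) set" where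
  "loop_class X p = {q. homotopic_paths X p q}"

definition fundamental_group :: "'a::topological_space set \<Rightarrow> 'a \<Rightarrow> (real \<Rightarrow> 'a) set monoid" where
  "fundamental_group X b =
     \<lparr>carrier = loop_class X ` loops X b,
      monoid.mult = (\<lambda>A B. {r. \<exists>p \<in> A. \<exists>q \<in> B. homotopic_paths X (p +++ q) r}),
      one = loop_class X (\<lambda>_. b)\<rparr>"

section \<open>Links in the 3-sphere\<close>

text \<open>The 3-sphere is the unit sphere of \<open>\<complex> \<times> \<complex>\<close>. An oriented ordered link with \<open>l\<close>
  components is given by parametrised closed curves \<open>K 1, \<dots>, K l\<close>, each traversed once
  on \<open>[0,1]\<close>.\<close>

type_synonym link = "nat \<Rightarrow> real \<Rightarrow> complex \<times> complex"

abbreviation S3 :: "(complex \<times> complex) set" where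
  "S3 \<equiv> sphere 0 1"

definition link_set :: "nat \<Rightarrow> link \<Rightarrow> (complex \<times> complex) set" where
  "link_set l K = (\<Union>i \<in> {1..l}. K i ` {0..1})"

definition angle_dist :: "complex \<times> complex \<Rightarrow> complex \<times> complex \<Rightarrow> real" where
  "angle_dist x y = arccos (x \<bullet> y)"

text \<open>Nearest-point projection onto the link is well defined on the closed \<open>\<rho>\<close>-neighbourhood,
  so the open \<open>\<rho>\<close>-neighbourhood is an open tubular neighbourhood. Deleting it from the
  sphere gives the exterior.\<close>

definition tubular_radius :: "(complex \<times> complex) set \<Rightarrow> real \<Rightarrow> bool" where
  "tubular_radius L \<rho> \<longleftrightarrow>
     0 < \<rho> \<and> \<rho> < pi / 2 \<and>
     (\<forall>x \<in> S3. (\<exists>y \<in> L. angle_dist x y \<le> \<rho>) \<longrightarrow>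
        (\<exists>!y. y \<in> L \<and> (\<forall>y' \<in> L. angle_dist x y \<le> angle_dist x y')))"

definition link_exterior :: "(complex \<times> complex) set \<Rightarrow> real \<Rightarrow> (complex \<times> complex) set" where
  "link_exterior L \<rho> = {x \<in> S3. \<forall>y \<in> L. \<rho> \<le> angle_dist x y}"

definition coords :: "complex \<times> complex \<Rightarrow> real list" where
  "coords p = [Re (fst p), Im (fst p), Re (snd p), Im (snd p)]"

text \<open>\<open>u, v\<close> is an orthonormal basis of the normal plane in the sphere at \<open>p\<close> to the tangent
  vector \<open>T\<close>. The sphere is oriented as the boundary of the ball, so \<open>(T, u, v)\<close> is
  positive in the sphere iff \<open>(p, T, u, v)\<close> is positive in \<open>\<complex> \<times> \<complex>\<close>.\<close>

definition positive_normal_frame ::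
  "complex \<times> complex \<Rightarrow> complex \<times> complex \<Rightarrow> complex \<times> complex \<Rightarrow> complex \<times> complex \<Rightarrow> bool"
  where
  "positive_normal_frame p T u v \<longleftrightarrow>
     norm u = 1 \<and> norm v = 1 \<and> u \<bullet> v = 0 \<and>
     u \<bullet> p = 0 \<and> v \<bullet> p = 0 \<and> u \<bullet> T = 0 \<and> v \<bullet> T = 0 \<and>
     0 < Determinant.det (mat_of_rows_list 4 (map coords [p, T, u, v]))"

definition normal_circle ::
  "real \<Rightarrow> complex \<times> complex \<Rightarrow> complex \<times> complex \<Rightarrow> complex \<times> complex \<Rightarrow> real \<Rightarrow> complex \<times> complex"
  where
  "normal_circle \<rho> p u v r =
     cos \<rho> *\<^sub>R p + sin \<rho> *\<^sub>R (cos (2 * pi * r) *\<^sub>R u + sin (2 * pi * r) *\<^sub>R v)"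

text \<open>The positive meridians of the \<open>i\<close>th component: oriented boundaries of fibre discs of the
  tubular neighbourhood, joined to the base point by an arbitrary path.\<close>

definition positive_meridians ::
  "nat \<Rightarrow> link \<Rightarrow> real \<Rightarrow> complex \<times> complex \<Rightarrow> nat \<Rightarrow> (real \<Rightarrow> complex \<times> complex) set set"
  where
  "positive_meridians l K \<rho> b i =
     (let X = link_exterior (link_set l K) \<rho> in
      {loop_class X (\<delta> +++ normal_circle \<rho> (K i s) u v +++ reversepath \<delta>) | \<delta> s u v.
         s \<in> {0..1} \<and> positive_normal_frame (K i s) (vector_derivative (K i) (at s)) u v \<and>
         path \<delta> \<and> path_image \<delta> \<subseteq> X \<and> pathstart \<delta> = b \<and>
         pathfinish \<delta> = normal_circle \<rho> (K i s) u v 0})"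

definition link_group :: "nat \<Rightarrow> link \<Rightarrow> real \<Rightarrow> complex \<times> complex \<Rightarrow>
    (real \<Rightarrow> complex \<times> complex) set monoid" where
  "link_group l K \<rho> b = fundamental_group (link_exterior (link_set l K) \<rho>) b"

definition meridional_system ::
  "nat \<Rightarrow> link \<Rightarrow> real \<Rightarrow> complex \<times> complex \<Rightarrow> ((real \<Rightarrow> complex \<times> complex) set \<Rightarrow> exponent) \<Rightarrow> bool"
  where
  "meridional_system l K \<rho> b \<phi> \<longleftrightarrow>
     \<phi> \<in> epi (link_group l K \<rho> b) (Z_lattice l) \<and>
     (\<forall>i \<in> {1..l}. \<forall>\<mu> \<in> positive_meridians l K \<rho> b i. \<phi> \<mu> = basis_vec i)"

section \<open>Torus links\<close>

text \<open>\<open>torus_link l n m\<close> is \<open>T(l n, l m)\<close>: \<open>l\<close> parallel copies of the \<open>(n, m)\<close> torus knot on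
  the torus \<open>|z| = |w| = 1 / \<surd>2\<close>. A single copy meets a circle \<open>z = const\<close> in \<open>n\<close> equally
  spaced points, so the shifts by \<open>i / (l n)\<close> of a full turn space the \<open>l\<close> copies evenly.\<close>

definition torus_link :: "nat \<Rightarrow> nat \<Rightarrow> nat \<Rightarrow> link" where
  "torus_link l n m i s =
     (1 / sqrt 2) *\<^sub>R
       (cis (2 * pi * (real n * s)), cis (2 * pi * (real m * s + real i / (real l * real n))))"

text \<open>Generator 0 is \<open>\<alpha>\<close>, generator 1 is \<open>\<beta>\<close>, and generator \<open>i + 1\<close> is \<open>f\<^sub>i\<close>
  for \<open>1 \<le> i < l\<close>.\<close>

definition torus_relators :: "nat \<Rightarrow> nat \<Rightarrow> nat \<Rightarrow> word list" where
  "torus_relators l n m =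
     (let a = replicate n (0, True); b = replicate m (1, False)
      in (a @ b) # map (\<lambda>i. a @ [(i + 1, True)] @ b @ [(i + 1, False)]) [1..<l])"

definition torus_link_presentation ::
  "nat \<Rightarrow> nat \<Rightarrow> nat \<Rightarrow> ('a, 'b) monoid_scheme \<Rightarrow> ('a \<Rightarrow> exponent) \<Rightarrow> bool" where
  "torus_link_presentation l n m G \<phi> \<longleftrightarrow>
     (\<exists>g. presents G (l + 1) (torus_relators l n m) g \<and>
          \<phi> (g 0) = (\<Sum>i = 1..l. Poly_Mapping.single i (int m)) \<and>
          \<phi> (g 1) = (\<Sum>i = 1..l. Poly_Mapping.single i (int n)) \<and>
          (\<forall>i \<in> {1..<l}. \<phi> (g (i + 1)) = (\<Sum>j = 1..i. basis_vec j)))"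

text \<open>The one-variable polynomials of the answer, with indeterminate \<open>U\<close>; the divisions in
  \<open>A_poly\<close> and \<open>B_poly\<close> are exact. The gcd of rational polynomials is the monic one.\<close>

definition U_poly :: "nat \<Rightarrow> rat poly" where
  "U_poly d = Polynomial.monom 1 d - 1"

definition A_poly :: "nat \<Rightarrow> nat \<Rightarrow> rat poly" where
  "A_poly m n = U_poly (m * n) div U_poly m"

definition B_poly :: "nat \<Rightarrow> nat \<Rightarrow> rat poly" where
  "B_poly m n = U_poly (m * n) div U_poly n"

definition P_poly :: "nat \<Rightarrow> nat \<Rightarrow> nat \<Rightarrow> nat \<Rightarrow> rat poly" where
  "P_poly l m n k =
     (if k < l then U_poly (m * n) ^ (l - 1 - k) * (A_poly m n * B_poly m n)
      else gcd (A_poly m n) (B_poly m n))"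

definition at_U :: "nat \<Rightarrow> rat poly \<Rightarrow> laurent" where
  "at_U l p = poly (map_poly (Poly_Mapping.single 0) p) (\<Prod>i = 1..l. t_var i)"

end

theory Submission
  imports Defs
begin

text \<open>
  The group of the link enters only through its presentation. Three facts combine.

  \<^emph>\<open>The elementary ideals may be computed in any presentation.\<close> For a generating tuple of the
  group, take the module spanned by the Fox gradients of all words of value 1. It depends on the
  tuple alone, and the gradients of the relators of any presentation on this tuple span it,
  because on words of value 1 the gradient is additive and conjugation acts by a unit
  (\<open>deriv_normal_closure\<close>). A redundant generator \<open>x = w\<close> adds one coordinate and the gradient
  of \<open>x w\<^sup>-\<^sup>1\<close>, which shifts the size of the minors by one without changing the ideal that they
  generate (\<open>dets_extend\<close>). Two generating tuples are compared through their concatenation, which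
  extends both (\<open>dets_relation_module_independent\<close>).

  \<^emph>\<open>The minors of the torus presentation.\<close> With \<open>T\<^sub>i = t\<^sub>1 \<dots> t\<^sub>i\<close> and \<open>T\<^sub>0 = 1\<close>, the rows of its
  Fox matrix are \<open>(A, - T\<^sub>i B, 0, \<dots>, D, \<dots>, 0)\<close> for \<open>0 \<le> i < l\<close>, where \<open>D\<close> stands in the column of
  \<open>f\<^sub>i\<close> and is absent from row 0. Let \<open>1 \<le> k < l\<close>. A minor of size \<open>l + 1 - k\<close> that
  meets the columns of \<open>\<alpha>\<close> and \<open>\<beta>\<close> is \<open>D\<^sup>l\<^sup>-\<^sup>1\<^sup>-\<^sup>k A B\<close> times a determinant that vanishes at
  \<open>t\<^sub>1 = \<dots> = t\<^sub>l = 1\<close>, since two of its columns become proportional there; for the other minors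
  \<open>D = A (U\<^sup>m - 1) = B (U\<^sup>n - 1)\<close> supplies the same factor and a vanishing cofactor. So every
  minor is \<open>P\<^sub>k(U)\<close> times an element of augmentation 0. Conversely, triangular minors yield
  \<open>P\<^sub>k(U)\<close> times \<open>U\<^sup>m - 1\<close>, \<open>U\<^sup>n - 1\<close> and \<open>T\<^sub>i - 1\<close>. As \<open>m\<close> and \<open>n\<close> are coprime, the first two give
  \<open>U - 1 = T\<^sub>l - 1\<close>, and \<open>t\<^sub>i - 1\<close> is a unit times \<open>(T\<^sub>i - 1) - (T\<^sub>i\<^sub>-\<^sub>1 - 1)\<close>. For \<open>k = l\<close> the
  minors are the entries, which generate the same ideal as \<open>gcd(A, B)\<close>.

  \<^emph>\<open>The Groebner bases.\<close> Let the polynomial \<open>f\<close> be \<open>P(U) h\<close> with a Laurent polynomial \<open>h\<close>. As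
  \<open>P(0) \<noteq> 0\<close>, also \<open>h\<close> is a polynomial, and the leading monomial of \<open>f\<close> is that of \<open>h\<close> times
  \<open>U\<^sup>d\<close>, where \<open>d = deg P\<close>.
  If \<open>h\<close> is nonzero of augmentation 0, it is not constant, so some \<open>t\<^sub>i\<close> divides its leading monomial
  (\<open>reduced_groebner_basis_augmentation\<close>). Uniqueness of reduced bases identifies \<open>AG\<close>.
\<close>

section \<open>Determinantal ideals of modules of vectors\<close>

locale unital_subring =
  fixes R :: "'a::comm_ring_1 set"
  assumes zero_mem [simp]: "0 \<in> R" and one_mem [simp]: "1 \<in> R"
    and add_mem: "x \<in> R \<Longrightarrow> y \<in> R \<Longrightarrow> x + y \<in> R"
    and mult_mem: "x \<in> R \<Longrightarrow> y \<in> R \<Longrightarrow> x * y \<in> R"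
    and uminus_mem: "x \<in> R \<Longrightarrow> - x \<in> R"
begin

lemma diff_mem: "x \<in> R \<Longrightarrow> y \<in> R \<Longrightarrow> x - y \<in> R"
  using add_mem[of x "- y"] uminus_mem[of y] by simp

lemma sum_mem: "(\<And>i. i \<in> S \<Longrightarrow> f i \<in> R) \<Longrightarrow> sum f S \<in> R"
  by (induction S rule: infinite_finite_induct) (auto intro: add_mem)

lemma prod_mem: "(\<And>i. i \<in> S \<Longrightarrow> f i \<in> R) \<Longrightarrow> prod f S \<in> R"
  by (induction S rule: infinite_finite_induct) (auto intro: mult_mem)

lemma neg_one_power_mem: "(- 1) ^ n \<in> R"
  by (induction n) (auto intro: uminus_mem)

lemma sign_mem: "signof p \<in> R"
  by (cases p rule: sign_cases) (auto intro: uminus_mem)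

end

text \<open>An \<open>R\<close>-submodule of the ambient ring. Two subsets of \<open>R\<close> generate the same ideal exactly if they lie
  in the same \<open>J\<close>, and all comparisons of ideals below have this form.\<close>

definition ideal_over :: "'a::comm_ring_1 set \<Rightarrow> 'a set \<Rightarrow> bool" where
  "ideal_over R J \<longleftrightarrow> 0 \<in> J \<and> (\<forall>x \<in> J. \<forall>y \<in> J. x + y \<in> J) \<and> (\<forall>c \<in> R. \<forall>x \<in> J. c * x \<in> J)"

lemma ideal_overD:
  assumes "ideal_over R J"
  shows "0 \<in> J" "x \<in> J \<Longrightarrow> y \<in> J \<Longrightarrow> x + y \<in> J" "c \<in> R \<Longrightarrow> x \<in> J \<Longrightarrow> c * x \<in> J"
  using assms by (auto simp: ideal_over_def)

lemma ideal_over_sum: "ideal_over R J \<Longrightarrow> (\<And>i. i \<in> S \<Longrightarrow> f i \<in> J) \<Longrightarrow> sum f S \<in> J"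
  by (induction S rule: infinite_finite_induct) (auto simp: ideal_over_def)

text \<open>Vectors with \<open>N\<close> coordinates are functions on all natural numbers. The span is closed under
  changing the values outside \<open>{..<N}\<close>, so that these values never matter.\<close>

inductive_set lspan :: "'a::comm_ring_1 set \<Rightarrow> nat \<Rightarrow> (nat \<Rightarrow> 'a) set \<Rightarrow> (nat \<Rightarrow> 'a) set"
  for R :: "'a set" and N :: nat and X :: "(nat \<Rightarrow> 'a) set" where
  zero: "(\<And>s. s < N \<Longrightarrow> y s = 0) \<Longrightarrow> y \<in> lspan R N X"
| step: "x \<in> lspan R N X \<Longrightarrow> c \<in> R \<Longrightarrow> v \<in> X \<Longrightarrow> (\<And>s. s < N \<Longrightarrow> y s = x s + c * v s) \<Longrightarrow>
    y \<in> lspan R N X"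

lemma lspan_cong:
  assumes "x \<in> lspan R N X" "\<And>s. s < N \<Longrightarrow> y s = x s"
  shows "y \<in> lspan R N X"
  using assms
proof (induction arbitrary: y)
  case (zero x)
  then show ?case by (auto intro: lspan.zero)
next
  case (step x c v z)
  show ?case by (rule lspan.step[OF step.hyps(1-3)]) (use step in auto)
qed

lemma lspan_add:
  assumes "y \<in> lspan R N X" "x \<in> lspan R N X" "\<And>s. s < N \<Longrightarrow> z s = x s + y s"
  shows "z \<in> lspan R N X"
  using assms
proof (induction arbitrary: z)
  case (zero y)
  then show ?case using lspan_cong[of x R N X z] by auto
next
  case (step y c v w)
  have "(\<lambda>s. x s + y s) \<in> lspan R N X"
    by (rule step.IH) (use step in auto)
  then show ?case
    by (rule lspan.step[OF _ step.hyps(2,3)]) (use step in \<open>auto simp: add.assoc\<close>)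
qed

lemma (in unital_subring) lspan_scale:
  assumes "y \<in> lspan R N X" "c \<in> R" "\<And>s. s < N \<Longrightarrow> z s = c * y s"
  shows "z \<in> lspan R N X"
  using assms
proof (induction arbitrary: z)
  case (zero y)
  then show ?case by (auto intro!: lspan.zero)
next
  case (step y a v w)
  have "(\<lambda>s. c * y s) \<in> lspan R N X"
    by (rule step.IH) (use step in auto)
  then show ?case
    by (rule lspan.step[OF _ mult_mem[OF step.prems(1) step.hyps(2)] step.hyps(3)])
      (use step in \<open>auto simp: algebra_simps\<close>)
qed

lemma (in unital_subring) lspan_base:
  assumes "v \<in> X" "\<And>s. s < N \<Longrightarrow> y s = v s"
  shows "y \<in> lspan R N X"
  by (rule lspan.step[OF lspan.zero[of N "\<lambda>_. 0"] one_mem assms(1)]) (use assms in auto)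

lemma (in unital_subring) lspan_lspan:
  assumes "y \<in> lspan R N X" "X \<subseteq> lspan R N Y"
  shows "y \<in> lspan R N Y"
  using assms
proof (induction)
  case (zero y)
  then show ?case by (auto intro: lspan.zero)
next
  case (step x c v y)
  have "(\<lambda>s. c * v s) \<in> lspan R N Y"
    by (rule lspan_scale[of v]) (use step in auto)
  then show ?case
    by (rule lspan_add[of _ _ _ _ x]) (use step in auto)
qed

lemma (in unital_subring) lspan_entries:
  assumes "y \<in> lspan R N X" "\<And>v s. v \<in> X \<Longrightarrow> s < N \<Longrightarrow> v s \<in> R" "s < N"
  shows "y s \<in> R"
  using assms by induction (auto intro!: add_mem mult_mem)

definition pairing :: "nat \<Rightarrow> (nat \<Rightarrow> 'a::comm_ring_1) \<Rightarrow> (nat \<Rightarrow> 'a) \<Rightarrow> 'a" where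
  "pairing N r \<mu> = (\<Sum>s<N. r s * \<mu> s)"

definition pairing_det :: "nat \<Rightarrow> nat \<Rightarrow> (nat \<Rightarrow> nat \<Rightarrow> 'a::comm_ring_1) \<Rightarrow> (nat \<Rightarrow> nat \<Rightarrow> 'a) \<Rightarrow> 'a" where
  "pairing_det d N r \<mu> = Determinant.det (mat d d (\<lambda>(i, j). pairing N (r i) (\<mu> j)))"

text \<open>Arbitrary linear functionals take the place of coordinates. The ideal generated by \<open>dets\<close> is
  the determinantal ideal of the submodule \<open>K\<close>; it is visibly invariant under changes of
  generators of \<open>K\<close> and under coordinate changes.\<close>

definition dets :: "'a::comm_ring_1 set \<Rightarrow> nat \<Rightarrow> nat \<Rightarrow> (nat \<Rightarrow> 'a) set \<Rightarrow> 'a set" where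
  "dets R d N K = {pairing_det d N r \<mu> | r \<mu>. (\<forall>i<d. r i \<in> K) \<and> (\<forall>j<d. \<forall>s<N. \<mu> j s \<in> R)}"

lemma pairing_det_mem_dets:
  "(\<And>i. i < d \<Longrightarrow> r i \<in> K) \<Longrightarrow> (\<And>j s. j < d \<Longrightarrow> s < N \<Longrightarrow> \<mu> j s \<in> R) \<Longrightarrow>
    pairing_det d N r \<mu> \<in> dets R d N K"
  unfolding dets_def by blast

lemma pairing_commute: "pairing N r q = pairing N q r"
  unfolding pairing_def by (simp add: mult.commute)

lemma det_mat_cong:
  "(\<And>i j. i < d \<Longrightarrow> j < d \<Longrightarrow> f i j = g i j) \<Longrightarrow>
   Determinant.det (mat d d (\<lambda>(i, j). f i j)) = Determinant.det (mat d d (\<lambda>(i, j). g i j))"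
  by (rule arg_cong[of _ _ Determinant.det], rule eq_matI) auto

lemma pairing_det_transpose: "pairing_det d N r \<mu> = pairing_det d N \<mu> r"
proof -
  have "pairing_det d N r \<mu> = Determinant.det (transpose_mat (mat d d (\<lambda>(i, j). pairing N (r i) (\<mu> j))))"
    unfolding pairing_det_def by (rule det_transpose[symmetric, of _ d]) auto
  also have "transpose_mat (mat d d (\<lambda>(i, j). pairing N (r i) (\<mu> j))) = mat d d (\<lambda>(i, j). pairing N (\<mu> i) (r j))"
    by (rule eq_matI) (auto simp: pairing_commute)
  finally show ?thesis unfolding pairing_det_def .
qed

text \<open>In the Laplace expansion along row \<open>p\<close> the cofactors do not see that row.\<close>

lemma det_row_linear:
  fixes f g h :: "nat \<Rightarrow> nat \<Rightarrow> 'a::comm_ring_1"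
  assumes p: "p < d"
    and lin: "\<And>j. j < d \<Longrightarrow> f p j = g p j + c * h p j"
    and g: "\<And>i j. i < d \<Longrightarrow> j < d \<Longrightarrow> i \<noteq> p \<Longrightarrow> g i j = f i j"
    and h: "\<And>i j. i < d \<Longrightarrow> j < d \<Longrightarrow> i \<noteq> p \<Longrightarrow> h i j = f i j"
  shows "Determinant.det (mat d d (\<lambda>(i, j). f i j)) =
    Determinant.det (mat d d (\<lambda>(i, j). g i j)) + c * Determinant.det (mat d d (\<lambda>(i, j). h i j))"
proof -
  let ?M = "\<lambda>f. mat d d (\<lambda>(i, j). f i j)"
  have del: "mat_delete (?M u) p j = mat_delete (?M f) p j"
    if "\<And>i j. i < d \<Longrightarrow> j < d \<Longrightarrow> i \<noteq> p \<Longrightarrow> u i j = f i j" "j < d" for u :: "nat \<Rightarrow> nat \<Rightarrow> 'a" and j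
    unfolding mat_delete_def using that p by (intro eq_matI) auto
  have cof: "cofactor (?M g) p j = cofactor (?M f) p j" "cofactor (?M h) p j = cofactor (?M f) p j"
    if "j < d" for j
    unfolding cofactor_def using del[of g] del[of h] g h that by simp_all
  have exp: "Determinant.det (?M u) = (\<Sum>j<d. u p j * cofactor (?M u) p j)" for u :: "nat \<Rightarrow> nat \<Rightarrow> 'a"
    using laplace_expansion_row[of "?M u" d p] p by simp
  have "(\<Sum>j<d. f p j * cofactor (?M f) p j) =
      (\<Sum>j<d. g p j * cofactor (?M g) p j) + c * (\<Sum>j<d. h p j * cofactor (?M h) p j)"
    by (simp add: lin cof algebra_simps sum.distrib sum_distrib_left cong: sum.cong_simp)
  then show ?thesis unfolding exp .
qed

lemma pairing_det_row_linear:
  assumes "p < d" "\<And>s. s < N \<Longrightarrow> y s = x s + c * v s"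
  shows "pairing_det d N (r(p := y)) \<mu> = pairing_det d N (r(p := x)) \<mu> + c * pairing_det d N (r(p := v)) \<mu>"
  unfolding pairing_det_def
proof (rule det_row_linear[OF \<open>p < d\<close>])
  show "pairing N ((r(p := y)) p) (\<mu> j) = pairing N ((r(p := x)) p) (\<mu> j) + c * pairing N ((r(p := v)) p) (\<mu> j)" for j
    using assms(2) by (simp add: pairing_def sum.distrib sum_distrib_left algebra_simps)
qed auto

lemma pairing_det_row_zero:
  assumes "p < d" "\<And>s. s < N \<Longrightarrow> y s = 0"
  shows "pairing_det d N (r(p := y)) \<mu> = 0"
  using pairing_det_row_linear[OF assms(1), of N y y 1 y r \<mu>] assms(2) by simp

lemma pairing_det_lspan_rows:
  assumes J: "ideal_over R J"
    and gen: "\<And>r. (\<And>i. i < d \<Longrightarrow> r i \<in> X) \<Longrightarrow> pairing_det d N r \<mu> \<in> J"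
    and r: "\<And>i. i < d \<Longrightarrow> r i \<in> lspan R N X"
  shows "pairing_det d N r \<mu> \<in> J"
proof -
  \<comment> \<open>The rows are moved from \<open>X\<close> to its span one at a time, in increasing order.\<close>
  have "(\<And>i. i < p \<Longrightarrow> r i \<in> lspan R N X) \<Longrightarrow> (\<And>i. p \<le> i \<Longrightarrow> i < d \<Longrightarrow> r i \<in> X) \<Longrightarrow> p \<le> d \<Longrightarrow> pairing_det d N r \<mu> \<in> J"
    for p r
  proof (induction p arbitrary: r)
    case 0
    then show ?case using gen by simp
  next
    case (Suc p)
    then have p: "p < d" by simp
    have "pairing_det d N (r(p := y)) \<mu> \<in> J" if "y \<in> lspan R N X" for y
      using that
    proof induction
      case (zero y)
      then show ?case using pairing_det_row_zero[OF p] ideal_overD(1)[OF J] by metis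
    next
      case (step x c v y)
      have "pairing_det d N (r(p := v)) \<mu> \<in> J"
      proof (rule Suc.IH)
        show "(r(p := v)) i \<in> lspan R N X" if "i < p" for i
          using Suc.prems(1)[of i] that by auto
        show "(r(p := v)) i \<in> X" if "p \<le> i" "i < d" for i
          using step.hyps(3) Suc.prems(2)[of i] that by auto
      qed (use p in simp)
      then show ?case
        using step pairing_det_row_linear[OF p, of N y x c v r \<mu>] ideal_overD[OF J] by metis
    qed
    from this[of "r p"] show ?case using Suc.prems(1)[of p] by simp
  qed
  from this[of d r] r show ?thesis by simp
qed

definition unit_vector :: "nat \<Rightarrow> nat \<Rightarrow> 'a::comm_ring_1" where
  "unit_vector c = (\<lambda>s. if s = c then 1 else 0)"

lemma pairing_unit_vector:
  assumes "c < N"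
  shows "pairing N r (unit_vector c) = r c"
proof -
  have "pairing N r (unit_vector c) = (\<Sum>s<N. if s = c then r c else 0)"
    unfolding pairing_def unit_vector_def by (rule sum.cong) auto
  then show ?thesis using assms by simp
qed

lemma (in unital_subring) mem_lspan_unit_vectors:
  assumes "\<And>s. s < N \<Longrightarrow> y s \<in> R"
  shows "y \<in> lspan R N (unit_vector ` {..<N})"
proof -
  have "n \<le> N \<Longrightarrow> (\<lambda>s. if s < n then y s else 0) \<in> lspan R N (unit_vector ` {..<N})" for n
  proof (induction n)
    case 0
    then show ?case by (auto intro: lspan.zero)
  next
    case (Suc n)
    show ?case
      by (rule lspan.step[OF Suc.IH, of "y n" "unit_vector n"])
        (use Suc.prems assms in \<open>auto simp: unit_vector_def less_Suc_eq\<close>)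
  qed
  then have "(\<lambda>s. if s < N then y s else 0) \<in> lspan R N (unit_vector ` {..<N})" by simp
  then show ?thesis by (rule lspan_cong) simp
qed

text \<open>By multilinearity in the columns the functionals may be taken to be coordinates, and by
  alternation pairwise distinct ones.\<close>

lemma (in unital_subring) dets_subset_columns:
  assumes J: "ideal_over R J"
    and gen: "\<And>r c. (\<And>i. i < d \<Longrightarrow> r i \<in> K) \<Longrightarrow> (\<And>j. j < d \<Longrightarrow> c j < N) \<Longrightarrow> inj_on c {..<d} \<Longrightarrow>
      Determinant.det (mat d d (\<lambda>(i, j). r i (c j))) \<in> J"
  shows "dets R d N K \<subseteq> J"
proof
  fix x assume "x \<in> dets R d N K"
  then obtain r \<mu> where x: "x = pairing_det d N r \<mu>" and r: "\<And>i. i < d \<Longrightarrow> r i \<in> K"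
    and \<mu>: "\<And>j s. j < d \<Longrightarrow> s < N \<Longrightarrow> \<mu> j s \<in> R"
    unfolding dets_def by auto
  have "pairing_det d N \<mu> r \<in> J"
  proof (rule pairing_det_lspan_rows[OF J])
    show "\<mu> j \<in> lspan R N (unit_vector ` {..<N})" if "j < d" for j
      by (rule mem_lspan_unit_vectors) (rule \<mu>[OF that])
  next
    fix q :: "nat \<Rightarrow> nat \<Rightarrow> 'a"
    assume "\<And>j. j < d \<Longrightarrow> q j \<in> unit_vector ` {..<N}"
    then have "\<forall>j. \<exists>c. j < d \<longrightarrow> c < N \<and> q j = unit_vector c" by fastforce
    then obtain c where c: "\<And>j. j < d \<Longrightarrow> c j < N \<and> q j = unit_vector (c j)" by metis
    have eq: "pairing_det d N q r = Determinant.det (mat d d (\<lambda>(i, j). r i (c j)))"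
      by (subst pairing_det_transpose, unfold pairing_det_def, rule det_mat_cong)
        (simp add: pairing_unit_vector c)
    show "pairing_det d N q r \<in> J"
    proof (cases "inj_on c {..<d}")
      case True
      then show ?thesis unfolding eq using gen r c by blast
    next
      case False
      then obtain i j where ij: "i < d" "j < d" "i \<noteq> j" "c i = c j"
        unfolding inj_on_def by auto
      have "Determinant.det (mat d d (\<lambda>(i, j). r i (c j))) = 0"
        by (rule det_identical_columns[of _ d i j]) (use ij in \<open>auto intro!: eq_vecI\<close>)
      then show ?thesis unfolding eq using ideal_overD(1)[OF J] by simp
    qed
  qed
  then show "x \<in> J" unfolding x by (subst pairing_det_transpose)
qed

lemma (in unital_subring) dets_lspan_subset:
  assumes J: "ideal_over R J"
    and gen: "\<And>r c. (\<And>i. i < d \<Longrightarrow> r i \<in> X) \<Longrightarrow> (\<And>j. j < d \<Longrightarrow> c j < N) \<Longrightarrow> inj_on c {..<d} \<Longrightarrow>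
      Determinant.det (mat d d (\<lambda>(i, j). r i (c j))) \<in> J"
  shows "dets R d N (lspan R N X) \<subseteq> J"
proof (rule dets_subset_columns[OF J])
  fix r :: "nat \<Rightarrow> nat \<Rightarrow> 'a" and c
  assume r: "\<And>i. i < d \<Longrightarrow> r i \<in> lspan R N X" and c: "\<And>j. j < d \<Longrightarrow> c j < N" "inj_on c {..<d}"
  have eq: "pairing_det d N q (\<lambda>j. unit_vector (c j)) = Determinant.det (mat d d (\<lambda>(i, j). q i (c j)))" for q
    unfolding pairing_det_def by (rule det_mat_cong) (simp add: pairing_unit_vector c)
  show "Determinant.det (mat d d (\<lambda>(i, j). r i (c j))) \<in> J"
    unfolding eq[symmetric]
    by (rule pairing_det_lspan_rows[OF J _ r]) (auto simp: eq intro!: gen c)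
qed

lemma (in unital_subring) coordinate_det_mem_dets:
  assumes "\<And>i. i < d \<Longrightarrow> r i \<in> K" "\<And>j. j < d \<Longrightarrow> c j < N"
  shows "Determinant.det (mat d d (\<lambda>(i, j). r i (c j))) \<in> dets R d N K"
proof -
  have "Determinant.det (mat d d (\<lambda>(i, j). r i (c j))) = pairing_det d N r (\<lambda>j. unit_vector (c j))"
    unfolding pairing_det_def by (rule det_mat_cong) (simp add: pairing_unit_vector assms)
  then show ?thesis using assms by (auto simp: unit_vector_def intro!: pairing_det_mem_dets)
qed

lemma det_border:
  fixes f :: "nat \<Rightarrow> nat \<Rightarrow> 'a::comm_ring_1"
  assumes "\<And>j. j < d \<Longrightarrow> f d j = 0" "f d d = 1"
  shows "Determinant.det (mat (Suc d) (Suc d) (\<lambda>(i, j). f i j)) = Determinant.det (mat d d (\<lambda>(i, j). f i j))"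
proof -
  let ?M = "mat (Suc d) (Suc d) (\<lambda>(i, j). f i j)"
  have "Determinant.det ?M = (\<Sum>j<Suc d. f d j * cofactor ?M d j)"
    using laplace_expansion_row[of ?M "Suc d" d] by simp
  also have "\<dots> = cofactor ?M d d" using assms by simp
  also have "\<dots> = Determinant.det (mat_delete ?M d d)" unfolding cofactor_def by (simp flip: mult_2)
  also have "mat_delete ?M d d = mat d d (\<lambda>(i, j). f i j)"
    unfolding mat_delete_def by (rule eq_matI) auto
  finally show ?thesis .
qed

text \<open>In the coordinates \<open>(y + y\<^sub>N v, y\<^sub>N)\<close> the extended module is the direct sum of the old one and a
  free line. Hence its determinants of size \<open>d + 1\<close> generate the same ideal as those of
  size \<open>d\<close> of the old module.\<close>

lemma (in unital_subring) dets_extend: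
  assumes J: "ideal_over R J" and X: "\<And>x s. x \<in> X \<Longrightarrow> s < N \<Longrightarrow> x s \<in> R"
    and v: "\<And>s. s < N \<Longrightarrow> v s \<in> R"
  shows "dets R (Suc d) (Suc N) {y. y N \<in> R \<and> (\<lambda>s. y s + y N * v s) \<in> lspan R N X} \<subseteq> J \<longleftrightarrow>
    dets R d N (lspan R N X) \<subseteq> J"
    (is "dets R _ _ ?L \<subseteq> J \<longleftrightarrow> _")
proof
  assume sub: "dets R (Suc d) (Suc N) ?L \<subseteq> J"
  show "dets R d N (lspan R N X) \<subseteq> J"
  proof
    fix x assume "x \<in> dets R d N (lspan R N X)"
    then obtain r \<mu> where x: "x = pairing_det d N r \<mu>" and r: "\<And>i. i < d \<Longrightarrow> r i \<in> lspan R N X"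
      and \<mu>: "\<And>j s. j < d \<Longrightarrow> s < N \<Longrightarrow> \<mu> j s \<in> R"
      unfolding dets_def by auto
    \<comment> \<open>The new relation \<open>(- v, 1)\<close> becomes the last row. The old functionals are extended so that
      they vanish on it, which borders the old matrix by a unit vector.\<close>
    define r' where "r' i = (if i = d then (\<lambda>s. - v s)(N := 1) else (r i)(N := 0))" for i
    define \<mu>' where "\<mu>' j = (if j = d then unit_vector N else (\<mu> j)(N := pairing N v (\<mu> j)))" for j
    have "pairing_det (Suc d) (Suc N) r' \<mu>' = x"
      unfolding x pairing_det_def
    proof (subst det_border)
      show "pairing (Suc N) (r' d) (\<mu>' j) = 0" if "j < d" for j
        using that by (simp add: pairing_def r'_def \<mu>'_def sum_negf)
      show "pairing (Suc N) (r' d) (\<mu>' d) = 1"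
        by (simp add: \<mu>'_def pairing_unit_vector r'_def)
      show "Determinant.det (mat d d (\<lambda>(i, j). pairing (Suc N) (r' i) (\<mu>' j))) =
          Determinant.det (mat d d (\<lambda>(i, j). pairing N (r i) (\<mu> j)))"
        by (rule det_mat_cong) (simp add: pairing_def r'_def \<mu>'_def)
    qed
    moreover have "pairing_det (Suc d) (Suc N) r' \<mu>' \<in> dets R (Suc d) (Suc N) ?L"
    proof -
      have "r' i \<in> ?L" if "i < Suc d" for i
      proof (cases "i = d")
        case True
        then show ?thesis by (auto simp: r'_def intro!: lspan.zero)
      next
        case False
        then show ?thesis using r[of i] that by (auto simp: r'_def intro!: lspan_cong[of "r i"])
      qed
      moreover have "\<mu>' j s \<in> R" if "j < Suc d" "s < Suc N" for j s
        using that \<mu> v by (auto simp: \<mu>'_def unit_vector_def pairing_def less_Suc_eq intro!: sum_mem mult_mem)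
      ultimately show ?thesis by (rule pairing_det_mem_dets)
    qed
    ultimately show "x \<in> J" using sub by auto
  qed
next
  assume sub: "dets R d N (lspan R N X) \<subseteq> J"
  let ?L' = "{y. y N \<in> R \<and> y \<in> lspan R N X}"
  have "dets R (Suc d) (Suc N) ?L' \<subseteq> J"
  proof (rule dets_subset_columns[OF J])
    fix r :: "nat \<Rightarrow> nat \<Rightarrow> 'a" and c
    assume r: "\<And>i. i < Suc d \<Longrightarrow> r i \<in> ?L'" and c: "\<And>j. j < Suc d \<Longrightarrow> c j < Suc N" "inj_on c {..<Suc d}"
    let ?M = "mat (Suc d) (Suc d) (\<lambda>(i, j). r i (c j))"
    \<comment> \<open>Expand along the column of the new coordinate if it occurs, and along the first column
      otherwise. Either way the cofactors involve old coordinates only.\<close>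
    obtain j0 where j0: "j0 < Suc d" "\<And>j. j < Suc d \<Longrightarrow> j \<noteq> j0 \<Longrightarrow> c j < N"
    proof (cases "N \<in> c ` {..<Suc d}")
      case True
      then obtain j0 where "j0 < Suc d" "c j0 = N" by auto
      then show ?thesis using that[of j0] c by (metis inj_onD lessThan_iff less_Suc_eq)
    next
      case False
      then show ?thesis using that[of 0] c(1) by (metis image_eqI lessThan_iff less_Suc_eq zero_less_Suc)
    qed
    have entry: "r i (c j) \<in> R" if "i < Suc d" "j < Suc d" for i j
      using r[OF that(1)] c(1)[OF that(2)] lspan_entries[of "r i" N X "c j"] X by (auto simp: less_Suc_eq)
    have del: "Determinant.det (mat_delete ?M i j0) \<in> J" if i: "i < Suc d" for i
    proof -
      have "mat_delete ?M i j0 = mat d d (\<lambda>(i', j'). r (insert_index i i') (c (insert_index j0 j')))"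
        unfolding mat_delete_def insert_index_def by (rule eq_matI) auto
      moreover have "Determinant.det (mat d d (\<lambda>(i', j'). r (insert_index i i') (c (insert_index j0 j')))) \<in>
          dets R d N (lspan R N X)"
      proof (rule coordinate_det_mem_dets)
        show "r (insert_index i i') \<in> lspan R N X" if "i' < d" for i'
          using r[of "insert_index i i'"] that by (auto simp: insert_index_def)
        show "c (insert_index j0 j') < N" if "j' < d" for j'
          using j0(2)[of "insert_index j0 j'"] that by (auto simp: insert_index_def)
      qed
      ultimately show ?thesis using sub by auto
    qed
    have "Determinant.det ?M = (\<Sum>i<Suc d. r i (c j0) * cofactor ?M i j0)"
      using laplace_expansion_column[of ?M "Suc d" j0] j0(1) by simp
    also have "\<dots> = (\<Sum>i<Suc d. (r i (c j0) * (- 1) ^ (i + j0)) * Determinant.det (mat_delete ?M i j0))"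
      by (simp add: cofactor_def mult.assoc)
    also have "\<dots> \<in> J"
      by (intro ideal_over_sum[OF J] ideal_overD(3)[OF J] mult_mem entry neg_one_power_mem del)
        (use j0 in auto)
    finally show "Determinant.det ?M \<in> J" .
  qed
  moreover have "dets R (Suc d) (Suc N) ?L \<subseteq> dets R (Suc d) (Suc N) ?L'"
  proof
    fix x assume "x \<in> dets R (Suc d) (Suc N) ?L"
    then obtain r \<mu> where x: "x = pairing_det (Suc d) (Suc N) r \<mu>" and r: "\<And>i. i < Suc d \<Longrightarrow> r i \<in> ?L"
      and \<mu>: "\<And>j s. j < Suc d \<Longrightarrow> s < Suc N \<Longrightarrow> \<mu> j s \<in> R"
      unfolding dets_def by auto
    \<comment> \<open>The change of coordinates, together with its inverse transpose on the functionals.\<close>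
    define r' where "r' i = (\<lambda>s. r i s + r i N * v s)(N := r i N)" for i
    define \<mu>' where "\<mu>' j = (\<mu> j)(N := \<mu> j N - pairing N v (\<mu> j))" for j
    have "pairing (Suc N) (r i) (\<mu> j) = pairing (Suc N) (r' i) (\<mu>' j)" for i j
      by (simp add: pairing_def r'_def \<mu>'_def algebra_simps sum.distrib sum_distrib_left)
    then have "x = pairing_det (Suc d) (Suc N) r' \<mu>'" unfolding x pairing_det_def by simp
    moreover have "r' i \<in> ?L'" if "i < Suc d" for i
      using r[OF that] by (auto simp: r'_def intro: lspan_cong)
    moreover have "\<mu>' j s \<in> R" if "j < Suc d" "s < Suc N" for j s
      using that \<mu> v by (auto simp: \<mu>'_def pairing_def less_Suc_eq intro!: sum_mem mult_mem diff_mem)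
    ultimately show "x \<in> dets R (Suc d) (Suc N) ?L'" by (auto intro: pairing_det_mem_dets)
  qed
  ultimately show "dets R (Suc d) (Suc N) ?L \<subseteq> J" by auto
qed

lemma dets_relabel:
  assumes \<rho>: "bij_betw \<rho> {..<N} {..<N}" and K: "\<And>y. y \<in> K \<Longrightarrow> (\<lambda>s. y (\<rho> s)) \<in> K'"
  shows "dets R d N K \<subseteq> dets R d N K'"
proof
  fix x assume "x \<in> dets R d N K"
  then obtain r \<mu> where x: "x = pairing_det d N r \<mu>" and r: "\<And>i. i < d \<Longrightarrow> r i \<in> K"
    and \<mu>: "\<And>j s. j < d \<Longrightarrow> s < N \<Longrightarrow> \<mu> j s \<in> R"
    unfolding dets_def by auto
  have "pairing N (r i) (\<mu> j) = pairing N (\<lambda>s. r i (\<rho> s)) (\<lambda>s. \<mu> j (\<rho> s))" for i j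
    unfolding pairing_def by (rule sum.reindex_bij_betw[OF \<rho>, symmetric])
  then have "x = pairing_det d N (\<lambda>i s. r i (\<rho> s)) (\<lambda>j s. \<mu> j (\<rho> s))"
    unfolding x pairing_det_def by simp
  then show "x \<in> dets R d N K'"
    using K[OF r] \<mu> bij_betwE[OF \<rho>] by (auto intro!: pairing_det_mem_dets)
qed

text \<open>Brings an arbitrary choice of distinct rows into the increasing order in which \<open>submatrix\<close>
  lists them.\<close>

lemma enumerate_by_pick:
  fixes \<rho> :: "nat \<Rightarrow> nat"
  assumes inj: "inj_on \<rho> {..<d}"
  obtains p where "p permutes {0..<d}" "\<And>i. i < d \<Longrightarrow> \<rho> i = pick (\<rho> ` {..<d}) (p i)"
proof -
  let ?I = "\<rho> ` {..<d}"
  have card: "card ?I = d" using inj by (simp add: card_image)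
  define p where "p i = (if i < d then card {a \<in> ?I. a < \<rho> i} else i)" for i
  have pick: "pick ?I (p i) = \<rho> i" if "i < d" for i
    unfolding p_def using that by (simp add: pick_card_in_set)
  have "p i < d" if "i < d" for i
  proof -
    have "{a \<in> ?I. a < \<rho> i} \<subset> ?I" using that by auto
    then have "card {a \<in> ?I. a < \<rho> i} < card ?I" by (intro psubset_card_mono) auto
    then show ?thesis using that card by (simp add: p_def)
  qed
  moreover have "inj_on p {..<d}"
    using inj pick unfolding inj_on_def by (metis lessThan_iff)
  ultimately have "bij_betw p {0..<d} {0..<d}"
    using endo_inj_surj[of "{..<d}" p] by (auto simp: bij_betw_def atLeast0LessThan)
  then have "p permutes {0..<d}" by (rule bij_imp_permutes) (auto simp: p_def)
  then show ?thesis using that pick by metis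
qed

text \<open>The link to \<open>minors\<close>: up to sign, a determinant in coordinates either has a repeated row or
  column or is a minor.\<close>

lemma (in unital_subring) minors_subset_iff:
  assumes J: "ideal_over R J" and A: "A \<in> carrier_mat n N"
  shows "minors A d \<subseteq> J \<longleftrightarrow> dets R d N (lspan R N ((\<lambda>i s. A $$ (i, s)) ` {..<n})) \<subseteq> J"
    (is "_ \<longleftrightarrow> dets R d N (lspan R N ?X) \<subseteq> J")
proof
  assume sub: "dets R d N (lspan R N ?X) \<subseteq> J"
  show "minors A d \<subseteq> J"
  proof
    fix x assume "x \<in> minors A d"
    then obtain I C where x: "x = Determinant.det (submatrix A I C)" and I: "I \<subseteq> {..<n}" "card I = d"
      and C: "C \<subseteq> {..<N}" "card C = d"
      unfolding minors_def using A by auto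
    have "{i. i < n \<and> i \<in> I} = I" "{j. j < N \<and> j \<in> C} = C" using I C by auto
    then have "submatrix A I C = mat d d (\<lambda>(i, j). A $$ (pick I i, pick C j))"
      unfolding submatrix_def using A I C by auto
    moreover have "Determinant.det (mat d d (\<lambda>(i, j). (\<lambda>s. A $$ (pick I i, s)) (pick C j))) \<in>
        dets R d N (lspan R N ?X)"
    proof (rule coordinate_det_mem_dets)
      show "(\<lambda>s. A $$ (pick I i, s)) \<in> lspan R N ?X" if "i < d" for i
        by (rule lspan_base[OF imageI[of "pick I i"]]) (use pick_in_set_le[of i I] I that in auto)
      show "pick C j < N" if "j < d" for j
        using pick_in_set_le[of j C] C that by auto
    qed
    ultimately show "x \<in> J" unfolding x using sub by auto
  qed
next
  assume sub: "minors A d \<subseteq> J"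
  show "dets R d N (lspan R N ?X) \<subseteq> J"
  proof (rule dets_lspan_subset[OF J])
    fix r :: "nat \<Rightarrow> nat \<Rightarrow> 'a" and c
    assume r: "\<And>i. i < d \<Longrightarrow> r i \<in> ?X" and c: "\<And>j. j < d \<Longrightarrow> c j < N" "inj_on c {..<d}"
    from r have "\<forall>i. \<exists>a. i < d \<longrightarrow> a < n \<and> r i = (\<lambda>s. A $$ (a, s))" by fastforce
    then obtain \<rho> where \<rho>: "\<And>i. i < d \<Longrightarrow> \<rho> i < n \<and> r i = (\<lambda>s. A $$ (\<rho> i, s))" by metis
    have eq: "Determinant.det (mat d d (\<lambda>(i, j). r i (c j))) =
        Determinant.det (mat d d (\<lambda>(i, j). A $$ (\<rho> i, c j)))"
      by (rule det_mat_cong) (use \<rho> in simp)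
    show "Determinant.det (mat d d (\<lambda>(i, j). r i (c j))) \<in> J"
    proof (cases "inj_on \<rho> {..<d}")
      case False
      then obtain i j where ij: "i < d" "j < d" "i \<noteq> j" "\<rho> i = \<rho> j"
        unfolding inj_on_def by auto
      have "Determinant.det (mat d d (\<lambda>(i, j). A $$ (\<rho> i, c j))) = 0"
        by (rule det_identical_rows[of _ d i j]) (use ij in \<open>auto intro!: eq_vecI\<close>)
      then show ?thesis unfolding eq using ideal_overD(1)[OF J] by simp
    next
      case True
      let ?I = "\<rho> ` {..<d}" and ?C = "c ` {..<d}"
      obtain p where p: "p permutes {0..<d}" "\<And>i. i < d \<Longrightarrow> \<rho> i = pick ?I (p i)"
        using enumerate_by_pick[OF True] by blast
      obtain q where q: "q permutes {0..<d}" "\<And>i. i < d \<Longrightarrow> c i = pick ?C (q i)"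
        using enumerate_by_pick[OF c(2)] by blast
      have pq: "p i < d" "q i < d" if "i < d" for i
        using permutes_in_image[OF p(1), of i] permutes_in_image[OF q(1), of i] that by auto
      have I: "?I \<subseteq> {..<n}" "card ?I = d" and C: "?C \<subseteq> {..<N}" "card ?C = d"
        using \<rho> c True by (auto simp: card_image)
      have "{i. i < n \<and> i \<in> ?I} = ?I" "{j. j < N \<and> j \<in> ?C} = ?C" using I C by auto
      then have S: "submatrix A ?I ?C = mat d d (\<lambda>(i, j). A $$ (pick ?I i, pick ?C j))" (is "_ = ?S")
        unfolding submatrix_def using A I C by auto
      have "Determinant.det (mat d d (\<lambda>(i, j). A $$ (\<rho> i, c j))) =
          Determinant.det (mat d d (\<lambda>(i, j). mat d d (\<lambda>(i, j). A $$ (pick ?I i, c j)) $$ (p i, j)))"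
        by (rule det_mat_cong) (use p pq in simp)
      also have "\<dots> = signof p * Determinant.det (mat d d (\<lambda>(i, j). A $$ (pick ?I i, c j)))"
        by (rule det_permute_rows[OF _ p(1)]) simp
      also have "Determinant.det (mat d d (\<lambda>(i, j). A $$ (pick ?I i, c j))) =
          Determinant.det (transpose_mat (mat d d (\<lambda>(i, j). A $$ (pick ?I i, c j))))"
        by (rule det_transpose[symmetric, of _ d]) simp
      also have "transpose_mat (mat d d (\<lambda>(i, j). A $$ (pick ?I i, c j))) =
          mat d d (\<lambda>(j, i). transpose_mat ?S $$ (q j, i))"
        by (rule eq_matI) (use q pq in auto)
      also have "Determinant.det \<dots> = signof q * Determinant.det (transpose_mat ?S)"
        by (rule det_permute_rows[OF _ q(1)]) simp
      also have "Determinant.det (transpose_mat ?S) = Determinant.det ?S"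
        by (rule det_transpose[of _ d]) simp
      finally have det: "Determinant.det (mat d d (\<lambda>(i, j). A $$ (\<rho> i, c j))) =
        signof p * (signof q * Determinant.det (submatrix A ?I ?C))" unfolding S .
      have "Determinant.det (submatrix A ?I ?C) \<in> minors A d"
        unfolding minors_def using I C A by blast
      then show ?thesis
        unfolding eq det using sub by (intro ideal_overD(3)[OF J] sign_mem) auto
    qed
  qed
qed

lemma (in unital_subring) det_mem:
  assumes "A \<in> carrier_mat d d" "\<And>i j. i < d \<Longrightarrow> j < d \<Longrightarrow> A $$ (i, j) \<in> R"
  shows "Determinant.det A \<in> R"
  unfolding det_def'[OF assms(1)]
proof (intro sum_mem mult_mem sign_mem prod_mem)
  fix p i assume "p \<in> {p. p permutes {0..<d}}" "i \<in> {0..<d}"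
  then show "A $$ (i, p i) \<in> R" using permutes_in_image[of p "{0..<d}" i] assms(2) by auto
qed

lemma (in unital_subring) minors_mem:
  assumes A: "A \<in> carrier_mat n N" "\<And>i j. i < n \<Longrightarrow> j < N \<Longrightarrow> A $$ (i, j) \<in> R"
  shows "minors A d \<subseteq> R"
proof
  fix x assume "x \<in> minors A d"
  then obtain I C where x: "x = Determinant.det (submatrix A I C)" and I: "I \<subseteq> {..<n}" "card I = d"
    and C: "C \<subseteq> {..<N}" "card C = d"
    unfolding minors_def using A(1) by auto
  have IC: "{i. i < n \<and> i \<in> I} = I" "{j. j < N \<and> j \<in> C} = C" using I C by auto
  have pick: "pick I i < n" "pick C i < N" if "i < d" for i
    using pick_in_set_le[of i I] pick_in_set_le[of i C] I C that by auto
  show "x \<in> R"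
    unfolding x by (rule det_mem[of _ d]) (use A pick I C IC in \<open>auto simp: submatrix_def\<close>)
qed

section \<open>Fox calculus\<close>

lemma words_simps [simp]:
  "[] \<in> words N" "x # w \<in> words N \<longleftrightarrow> fst x < N \<and> w \<in> words N"
  "v @ w \<in> words N \<longleftrightarrow> v \<in> words N \<and> w \<in> words N"
  by (auto simp: words_def)

lemma words_mono: "N \<le> M \<Longrightarrow> w \<in> words N \<Longrightarrow> w \<in> words M"
  by (induction w) auto

lemma fst_letter_inv [simp]: "fst (letter_inv x) = fst x"
  by (simp add: letter_inv_def)

lemma word_inv_simps [simp]: "word_inv [] = []" "word_inv (x # w) = word_inv w @ [letter_inv x]"
  by (simp_all add: word_inv_def)

lemma word_inv_words [simp]: "word_inv w \<in> words N \<longleftrightarrow> w \<in> words N"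
  by (induction w) auto

lemma normal_closure_words: "w \<in> normal_closure N S \<Longrightarrow> S \<subseteq> words N \<Longrightarrow> w \<in> words N"
  by (induction rule: normal_closure.induct) auto

lemma fox_words: "(c, v) \<in> set (fox j w) \<Longrightarrow> w \<in> words N \<Longrightarrow> v \<in> words N"
  by (induction w arbitrary: c v rule: fox.induct) (auto split: if_splits)

text \<open>The endomorphism of free groups that sends the generator \<open>i\<close> to \<open>\<sigma> i\<close>, on words.\<close>

definition subst_word :: "(nat \<Rightarrow> word) \<Rightarrow> word \<Rightarrow> word" where
  "subst_word \<sigma> w = concat (map (\<lambda>(i, s). if s then \<sigma> i else word_inv (\<sigma> i)) w)"

lemma subst_word_simps [simp]:
  "subst_word \<sigma> [] = []"
  "subst_word \<sigma> ((i, s) # w) = (if s then \<sigma> i else word_inv (\<sigma> i)) @ subst_word \<sigma> w"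
  by (simp_all add: subst_word_def)

lemma subst_word_words:
  "w \<in> words M \<Longrightarrow> (\<And>i. i < M \<Longrightarrow> \<sigma> i \<in> words N) \<Longrightarrow> subst_word \<sigma> w \<in> words N"
  by (induction w) auto

context group
begin

lemma letter_value_closed [simp]:
  "g ` {..<N} \<subseteq> carrier G \<Longrightarrow> fst x < N \<Longrightarrow> letter_value G g x \<in> carrier G"
  by (auto simp: letter_value_def)

lemma word_value_simps [simp]:
  "word_value G g [] = \<one>" "word_value G g (x # w) = letter_value G g x \<otimes> word_value G g w"
  by (simp_all add: word_value_def)

lemma word_value_closed [simp]:
  "g ` {..<N} \<subseteq> carrier G \<Longrightarrow> w \<in> words N \<Longrightarrow> word_value G g w \<in> carrier G"
  by (induction w) auto

lemma word_value_append:
  "g ` {..<N} \<subseteq> carrier G \<Longrightarrow> v \<in> words N \<Longrightarrow> w \<in> words N \<Longrightarrow>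
    word_value G g (v @ w) = word_value G g v \<otimes> word_value G g w"
  by (induction v) (auto simp: m_assoc)

lemma letter_value_inv:
  "g ` {..<N} \<subseteq> carrier G \<Longrightarrow> fst x < N \<Longrightarrow> letter_value G g (letter_inv x) = inv letter_value G g x"
  by (auto simp: letter_value_def letter_inv_def image_subset_iff)

lemma word_value_inv:
  "g ` {..<N} \<subseteq> carrier G \<Longrightarrow> w \<in> words N \<Longrightarrow> word_value G g (word_inv w) = inv word_value G g w"
  by (induction w) (auto simp: word_value_append letter_value_inv inv_mult_group)

lemma word_value_cong:
  "(\<And>i. i < N \<Longrightarrow> g i = h i) \<Longrightarrow> w \<in> words N \<Longrightarrow> word_value G g w = word_value G h w"
  by (induction w) (auto simp: letter_value_def)

lemma word_value_subst:
  assumes g: "g ` {..<N} \<subseteq> carrier G" and h: "h ` {..<M} \<subseteq> carrier G"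
    and \<sigma>: "\<And>i. i < M \<Longrightarrow> \<sigma> i \<in> words N" "\<And>i. i < M \<Longrightarrow> word_value G g (\<sigma> i) = h i"
  shows "w \<in> words M \<Longrightarrow> word_value G g (subst_word \<sigma> w) = word_value G h w"
proof (induction w)
  case (Cons x w)
  obtain i s where x: "x = (i, s)" by fastforce
  then have i: "i < M" and w: "w \<in> words M" using Cons.prems by auto
  show ?case
    using Cons.IH[OF w] word_value_append[OF g _ subst_word_words[OF w \<sigma>(1)], of "\<sigma> i"]
      word_value_append[OF g _ subst_word_words[OF w \<sigma>(1)], of "word_inv (\<sigma> i)"] i \<sigma>
      word_value_inv[OF g \<sigma>(1)[OF i]]
    by (auto simp: x letter_value_def)
qed simp

end

text \<open>The values of \<open>\<tau>\<close> are units of \<open>R\<close>, with inverses the values at the inverses. Fox derivatives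
  are evaluated along \<open>\<tau>\<close>.\<close>

locale group_character = group G + unital_subring R
  for G (structure) and R :: "'r::comm_ring_1 set" +
  fixes \<tau> :: "'a \<Rightarrow> 'r"
  assumes character_mem: "x \<in> carrier G \<Longrightarrow> \<tau> x \<in> R"
    and character_one [simp]: "\<tau> \<one> = 1"
    and character_mult: "x \<in> carrier G \<Longrightarrow> y \<in> carrier G \<Longrightarrow> \<tau> (x \<otimes> y) = \<tau> x * \<tau> y"
begin

lemma character_inv: "x \<in> carrier G \<Longrightarrow> \<tau> (inv x) * \<tau> x = 1" "x \<in> carrier G \<Longrightarrow> \<tau> x * \<tau> (inv x) = 1"
  by (simp_all flip: character_mult)

definition deriv :: "(nat \<Rightarrow> 'a) \<Rightarrow> word \<Rightarrow> nat \<Rightarrow> 'r" where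
  "deriv g w j = sum_list (map (\<lambda>(c, v). of_int c * \<tau> (word_value G g v)) (fox j w))"

lemma deriv_Nil [simp]: "deriv g [] j = 0"
  by (simp add: deriv_def)

lemma deriv_Cons:
  assumes "g ` {..<N} \<subseteq> carrier G" "x # w \<in> words N"
  shows "deriv g (x # w) j =
    (if fst x = j then if snd x then 1 else - \<tau> (inv g j) else 0) + \<tau> (letter_value G g x) * deriv g w j"
proof -
  obtain i s where x: "x = (i, s)" by fastforce
  have i: "i < N" "g i \<in> carrier G" and w: "w \<in> words N" using assms x by auto
  have "sum_list (map (\<lambda>(c, v). of_int c * \<tau> (word_value G g v)) (map (\<lambda>(c, v). (c, (i, s) # v)) L)) =
      \<tau> (letter_value G g x) * sum_list (map (\<lambda>(c, v). of_int c * \<tau> (word_value G g v)) L)"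
    if "\<And>c v. (c, v) \<in> set L \<Longrightarrow> v \<in> words N" for L
    using that
  proof (induction L)
    case (Cons y L)
    obtain c v where y: "y = (c, v)" by fastforce
    then have "v \<in> words N" using Cons.prems by auto
    moreover have "sum_list (map (\<lambda>(c, v). of_int c * \<tau> (word_value G g v)) (map (\<lambda>(c, v). (c, (i, s) # v)) L)) =
        \<tau> (letter_value G g x) * sum_list (map (\<lambda>(c, v). of_int c * \<tau> (word_value G g v)) L)"
      by (rule Cons.IH) (use Cons.prems in auto)
    ultimately show ?case
      using assms(1) i by (simp add: y x character_mult algebra_simps)
  qed simp
  from this[of "fox j w"] fox_words[OF _ w] show ?thesis
    using i by (auto simp: deriv_def x letter_value_def)
qed

lemma deriv_append:
  assumes g: "g ` {..<N} \<subseteq> carrier G"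
  shows "v \<in> words N \<Longrightarrow> w \<in> words N \<Longrightarrow>
    deriv g (v @ w) j = deriv g v j + \<tau> (word_value G g v) * deriv g w j"
proof (induction v)
  case (Cons x v)
  then show ?case
    using g by (simp add: deriv_Cons[OF g] character_mult algebra_simps)
qed simp

lemma deriv_letter_inv:
  assumes g: "g ` {..<N} \<subseteq> carrier G" and x: "fst x < N"
  shows "deriv g [letter_inv x] j = - \<tau> (inv letter_value G g x) * deriv g [x] j"
proof -
  have "g (fst x) \<in> carrier G" using g x by auto
  then show ?thesis
    using x by (auto simp: deriv_Cons[OF g] letter_inv_def letter_value_def character_inv)
qed

lemma deriv_word_inv:
  assumes g: "g ` {..<N} \<subseteq> carrier G"
  shows "w \<in> words N \<Longrightarrow> deriv g (word_inv w) j = - \<tau> (inv word_value G g w) * deriv g w j"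
proof (induction w)
  case (Cons x w)
  let ?x = "letter_value G g x" and ?w = "word_value G g w"
  have cl: "?x \<in> carrier G" "?w \<in> carrier G" using Cons.prems g by auto
  have x: "deriv g (x # w) j = deriv g [x] j + \<tau> ?x * deriv g w j"
    using Cons.prems deriv_append[OF g, of "[x]" w] cl by simp
  have "deriv g (word_inv (x # w)) j =
      - \<tau> (inv ?w) * deriv g w j + \<tau> (inv ?w) * (- \<tau> (inv ?x) * deriv g [x] j)"
    using Cons deriv_append[OF g, of "word_inv w" "[letter_inv x]"] deriv_letter_inv[OF g, of x]
      word_value_inv[OF g] by simp
  also have "\<dots> = - (\<tau> (inv ?w) * (\<tau> (inv ?x) * \<tau> ?x) * deriv g w j) - \<tau> (inv ?w) * \<tau> (inv ?x) * deriv g [x] j"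
    using character_inv(1)[OF cl(1)] by (simp add: algebra_simps)
  also have "\<dots> = - (\<tau> (inv ?w) * \<tau> (inv ?x)) * (deriv g [x] j + \<tau> ?x * deriv g w j)"
    by (simp add: algebra_simps)
  also have "\<dots> = - \<tau> (inv word_value G g (x # w)) * deriv g (x # w) j"
    using cl by (simp add: x inv_mult_group character_mult)
  finally show ?case .
qed simp

lemma deriv_mem:
  assumes g: "g ` {..<N} \<subseteq> carrier G"
  shows "w \<in> words N \<Longrightarrow> deriv g w j \<in> R"
proof (induction w)
  case (Cons x w)
  have "\<tau> (inv g (fst x)) \<in> R" using g Cons.prems by (intro character_mem) auto
  then show ?case
    using Cons g by (auto simp: deriv_Cons[OF g] intro!: add_mem diff_mem mult_mem uminus_mem character_mem)
qed simp

lemma deriv_outside: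
  assumes g: "g ` {..<N} \<subseteq> carrier G" and "N \<le> j"
  shows "w \<in> words N \<Longrightarrow> deriv g w j = 0"
  by (induction w) (use assms in \<open>auto simp: deriv_Cons[OF g]\<close>)

lemma deriv_generator: "i < N \<Longrightarrow> g ` {..<N} \<subseteq> carrier G \<Longrightarrow> deriv g [(i, True)] j = (if i = j then 1 else 0)"
  by (simp add: deriv_Cons)

text \<open>Words are not reduced, so invariance under free cancellation has to be checked.\<close>

lemma cancel_letters:
  assumes g: "g ` {..<N} \<subseteq> carrier G" and "v \<in> words N" "fst x < N" "w \<in> words N"
  shows "word_value G g (v @ [x, letter_inv x] @ w) = word_value G g (v @ w)"
    and "deriv g (v @ [x, letter_inv x] @ w) = deriv g (v @ w)"
proof -
  let ?x = "letter_value G g x"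
  have x: "?x \<in> carrier G" "word_value G g w \<in> carrier G" using assms by auto
  have val: "word_value G g ([x, letter_inv x] @ w) = word_value G g w"
    using assms x by (simp add: letter_value_inv[OF g] m_assoc[symmetric])
  then show "word_value G g (v @ [x, letter_inv x] @ w) = word_value G g (v @ w)"
    using assms word_value_append[OF g, of v "[x, letter_inv x] @ w"] word_value_append[OF g, of v w] by simp
  have "deriv g ([x, letter_inv x] @ w) j = deriv g w j" for j
  proof -
    have "deriv g ([x] @ [letter_inv x] @ w) j = deriv g [x] j + \<tau> ?x *
        (- \<tau> (inv ?x) * deriv g [x] j + \<tau> (inv ?x) * deriv g w j)"
      using assms x deriv_append[OF g, of "[x]" "[letter_inv x] @ w"] deriv_append[OF g, of "[letter_inv x]" w]
        deriv_letter_inv[OF g, of x] letter_value_inv[OF g, of x] by simp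
    also have "\<dots> = deriv g [x] j - (\<tau> ?x * \<tau> (inv ?x)) * deriv g [x] j + (\<tau> ?x * \<tau> (inv ?x)) * deriv g w j"
      by (simp add: algebra_simps)
    finally show ?thesis using character_inv(2)[OF x(1)] by simp
  qed
  then show "deriv g (v @ [x, letter_inv x] @ w) = deriv g (v @ w)"
    using assms deriv_append[OF g, of v "[x, letter_inv x] @ w"] deriv_append[OF g, of v w] by (intro ext) simp
qed

text \<open>The chain rule of the Fox calculus.\<close>

lemma deriv_subst:
  assumes g: "g ` {..<N} \<subseteq> carrier G" and h: "h ` {..<M} \<subseteq> carrier G"
    and \<sigma>: "\<And>i. i < M \<Longrightarrow> \<sigma> i \<in> words N" "\<And>i. i < M \<Longrightarrow> word_value G g (\<sigma> i) = h i"
  shows "w \<in> words M \<Longrightarrow> deriv g (subst_word \<sigma> w) s = (\<Sum>i<M. deriv h w i * deriv g (\<sigma> i) s)"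
proof (induction w)
  case (Cons x w)
  obtain i b where x: "x = (i, b)" by fastforce
  then have i: "i < M" and w: "w \<in> words M" using Cons.prems by auto
  let ?u = "if b then \<sigma> i else word_inv (\<sigma> i)"
  have u: "?u \<in> words N" "subst_word \<sigma> w \<in> words N"
    using \<sigma>(1)[OF i] subst_word_words[OF w \<sigma>(1)] by auto
  have val: "word_value G g ?u = letter_value G h x"
    using \<sigma>[OF i] word_value_inv[OF g] by (simp add: x letter_value_def)
  have "deriv h (x # w) k * deriv g (\<sigma> k) s =
      (if k = i then (if b then 1 else - \<tau> (inv h i)) * deriv g (\<sigma> i) s else 0) +
      \<tau> (letter_value G h x) * (deriv h w k * deriv g (\<sigma> k) s)" for k
    using deriv_Cons[OF h, of x w k] Cons.prems by (auto simp: x algebra_simps)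
  then have "(\<Sum>k<M. deriv h (x # w) k * deriv g (\<sigma> k) s) =
      (if b then 1 else - \<tau> (inv h i)) * deriv g (\<sigma> i) s +
      \<tau> (letter_value G h x) * (\<Sum>k<M. deriv h w k * deriv g (\<sigma> k) s)"
    using i by (simp add: sum.distrib sum_distrib_left)
  also have "(if b then 1 else - \<tau> (inv h i)) * deriv g (\<sigma> i) s = deriv g ?u s"
    using \<sigma>[OF i] deriv_word_inv[OF g] by simp
  finally show ?case
    using deriv_append[OF g u, of s] val Cons.IH[OF w] by (simp add: x)
qed simp

text \<open>The cokernel of this module is the Alexander module. The definition refers to the generating
  tuple and not to relators.\<close>

definition relation_module :: "nat \<Rightarrow> (nat \<Rightarrow> 'a) \<Rightarrow> (nat \<Rightarrow> 'r) set" where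
  "relation_module N g = lspan R N {deriv g w | w. w \<in> words N \<and> word_value G g w = \<one>}"

text \<open>The twisting factors in the product rule are values of \<open>\<tau>\<close> at words of value \<open>\<one>\<close>, hence 1,
  except for a conjugating word, which contributes a unit.\<close>

lemma deriv_normal_closure:
  assumes g: "g ` {..<N} \<subseteq> carrier G" and S: "S \<subseteq> words N" "\<And>r. r \<in> S \<Longrightarrow> word_value G g r = \<one>"
  shows "w \<in> normal_closure N S \<Longrightarrow> word_value G g w = \<one> \<and> deriv g w \<in> lspan R N (deriv g ` S)"
proof (induction rule: normal_closure.induct)
  case empty
  then show ?case by (auto intro: lspan.zero)
next
  case (relator r)
  then show ?case using S by (auto intro: lspan_base)
next
  case (inverse w)
  then have "w \<in> words N" using normal_closure_words S(1) by blast
  moreover have "deriv g (word_inv w) \<in> lspan R N (deriv g ` S)"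
    by (rule lspan_scale[of "deriv g w" _ _ "- 1"])
      (use inverse calculation deriv_word_inv[OF g] uminus_mem in auto)
  ultimately show ?case using word_value_inv[OF g] inverse by simp
next
  case (product v w)
  then have "v \<in> words N" "w \<in> words N" using normal_closure_words S(1) by blast+
  moreover have "deriv g (v @ w) \<in> lspan R N (deriv g ` S)"
    by (rule lspan_add[of "deriv g w" _ _ _ "deriv g v"])
      (use product calculation deriv_append[OF g] in auto)
  ultimately show ?case using word_value_append[OF g] product by simp
next
  case (conjugate w v)
  then have w: "w \<in> words N" using normal_closure_words S(1) by blast
  have cl: "word_value G g v \<in> carrier G" using conjugate g by simp
  have "deriv g (v @ w @ word_inv v) j = \<tau> (word_value G g v) * deriv g w j" for j
  proof -
    have "deriv g (v @ w @ word_inv v) j = deriv g v j + \<tau> (word_value G g v) *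
        (deriv g w j + \<tau> (word_value G g w) * (- \<tau> (inv word_value G g v) * deriv g v j))"
      using conjugate w by (simp add: deriv_append[OF g] deriv_word_inv[OF g])
    also have "\<dots> = deriv g v j + \<tau> (word_value G g v) * deriv g w j -
        (\<tau> (word_value G g v) * \<tau> (inv word_value G g v)) * deriv g v j"
      using conjugate by (simp add: algebra_simps)
    finally show ?thesis using character_inv(2)[OF cl] by simp
  qed
  then have "deriv g (v @ w @ word_inv v) \<in> lspan R N (deriv g ` S)"
    using lspan_scale[of "deriv g w", OF _ character_mem[OF cl]] conjugate.IH by blast
  moreover have "word_value G g (v @ w @ word_inv v) = \<one>"
    using conjugate w cl word_value_append[OF g] word_value_inv[OF g] by simp
  ultimately show ?case by simp
next
  case (cancel v x w)
  then have "v @ [x, letter_inv x] @ w \<in> words N" using normal_closure_words S(1) by blast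
  then show ?case using cancel.IH cancel_letters[OF g, of v x w] by simp
next
  case (insert v w x)
  then have "v @ w \<in> words N" using normal_closure_words S(1) by blast
  then show ?case using insert cancel_letters[OF g, of v x w] by simp
qed

text \<open>A presentation says that the words of value \<open>\<one>\<close> are the normal closure of the relators, so
  the rows of the Fox matrix span the relation module.\<close>

lemma relation_module_presents:
  assumes pres: "presents G N rs g"
  shows "relation_module N g =
    lspan R N ((\<lambda>i s. mat (length rs) N (\<lambda>(i, j). deriv g (rs ! i) j) $$ (i, s)) ` {..<length rs})"
    (is "_ = lspan R N ?Y")
proof (intro subset_antisym subsetI)
  have g: "g ` {..<N} \<subseteq> carrier G" and rs: "set rs \<subseteq> words N"
    and nc: "\<And>w. w \<in> words N \<Longrightarrow> word_value G g w = \<one> \<longleftrightarrow> w \<in> normal_closure N (set rs)"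
    using pres by (auto simp: presents_def)
  have rs1: "word_value G g r = \<one>" if "r \<in> set rs" for r
    using nc[of r] rs that normal_closure.relator by blast
  fix y
  {
    assume "y \<in> relation_module N g"
    then show "y \<in> lspan R N ?Y"
      unfolding relation_module_def
    proof (rule lspan_lspan, intro subsetI)
      fix x assume "x \<in> {deriv g w | w. w \<in> words N \<and> word_value G g w = \<one>}"
      then obtain w where x: "x = deriv g w" and w: "w \<in> normal_closure N (set rs)"
        using nc by auto
      have "x \<in> lspan R N (deriv g ` set rs)"
        unfolding x using deriv_normal_closure[OF g rs rs1 w] by simp
      then show "x \<in> lspan R N ?Y"
      proof (rule lspan_lspan, intro subsetI)
        fix z assume "z \<in> deriv g ` set rs"
        then obtain i where i: "i < length rs" "z = deriv g (rs ! i)"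
          by (auto simp: in_set_conv_nth)
        show "z \<in> lspan R N ?Y"
          by (rule lspan_base[OF imageI[of i]]) (use i in auto)
      qed
    qed
  next
    assume "y \<in> lspan R N ?Y"
    then show "y \<in> relation_module N g"
      unfolding relation_module_def
    proof (rule lspan_lspan, intro subsetI)
      fix x assume "x \<in> ?Y"
      then obtain i where i: "i < length rs" "\<And>s. s < N \<Longrightarrow> x s = deriv g (rs ! i) s" by auto
      have "deriv g (rs ! i) \<in> {deriv g w | w. w \<in> words N \<and> word_value G g w = \<one>}"
        using rs rs1 i nth_mem by blast
      then show "x \<in> lspan R N {deriv g w | w. w \<in> words N \<and> word_value G g w = \<one>}"
        by (rule lspan_base) (use i in auto)
    qed
  }
qed

text \<open>Substituting \<open>w\<close> for the new generator turns relations into relations of the old tuple;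
  by the chain rule this sends the gradient \<open>y\<close> to \<open>y + y\<^sub>N (\<partial>w)\<close>. In the other direction, the
  only relation that has to be added is \<open>x\<^sub>N w\<^sup>-\<^sup>1\<close>, with gradient \<open>(- \<partial>w, 1)\<close>.\<close>

lemma relation_module_extend:
  assumes g: "g ` {..<Suc N} \<subseteq> carrier G" and w: "w \<in> words N" "word_value G g w = g N"
  shows "relation_module (Suc N) g =
    {y. y N \<in> R \<and> (\<lambda>s. y s + y N * deriv g w s) \<in> relation_module N g}"
proof (intro subset_antisym subsetI)
  have gN: "g ` {..<N} \<subseteq> carrier G" using g by auto
  let ?X = "\<lambda>N. {deriv g w | w. w \<in> words N \<and> word_value G g w = \<one>}"
  fix y
  assume "y \<in> relation_module (Suc N) g"
  then show "y \<in> {y. y N \<in> R \<and> (\<lambda>s. y s + y N * deriv g w s) \<in> relation_module N g}"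
    unfolding relation_module_def
  proof induction
    case (zero y)
    then show ?case by (auto intro: lspan.zero)
  next
    case (step x c u y)
    then obtain u' where u: "u = deriv g u'" and u': "u' \<in> words (Suc N)" "word_value G g u' = \<one>" by auto
    define \<sigma> where "\<sigma> i = (if i < N then [(i, True)] else w)" for i
    have \<sigma>: "\<sigma> i \<in> words N" "word_value G g (\<sigma> i) = g i" if "i < Suc N" for i
      using that w gN by (auto simp: \<sigma>_def less_Suc_eq letter_value_def image_subset_iff)
    have "deriv g (subst_word \<sigma> u') s = u s + u N * deriv g w s" if "s < N" for s
    proof -
      have "deriv g (subst_word \<sigma> u') s = (\<Sum>i<Suc N. u i * deriv g (\<sigma> i) s)"
        unfolding u by (rule deriv_subst[OF gN g \<sigma> u'(1)])
      also have "\<dots> = (\<Sum>i<N. if i = s then u s else 0) + u N * deriv g w s"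
        by (simp add: \<sigma>_def deriv_generator[OF _ gN] if_distrib cong: if_cong)
      finally show ?thesis using that by simp
    qed
    moreover have "deriv g (subst_word \<sigma> u') \<in> ?X N"
      using subst_word_words[OF u'(1) \<sigma>(1)] word_value_subst[OF gN g \<sigma> u'(1)] u'(2) by auto
    moreover have "u N \<in> R" unfolding u by (rule deriv_mem[OF g u'(1)])
    ultimately show ?case
      using step lspan.step[of "\<lambda>s. x s + x N * deriv g w s" R N "?X N" c "deriv g (subst_word \<sigma> u')" "\<lambda>s. y s + y N * deriv g w s"]
      by (auto simp: algebra_simps intro!: add_mem mult_mem)
  qed
next
  have gN: "g ` {..<N} \<subseteq> carrier G" using g by auto
  let ?X = "\<lambda>N. {deriv g w | w. w \<in> words N \<and> word_value G g w = \<one>}"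
  have incl: "z \<in> lspan R N (?X N) \<Longrightarrow> z(N := 0) \<in> lspan R (Suc N) (?X (Suc N))" for z
  proof (induction rule: lspan.induct)
    case (zero z)
    then show ?case by (auto intro!: lspan.zero)
  next
    case (step x c v z)
    have "v \<in> ?X (Suc N)" using step.hyps(3) words_mono[of N "Suc N"] by auto
    moreover have "v N = 0" using step.hyps(3) deriv_outside[OF gN, of N] by auto
    ultimately show ?case
      using step by (intro lspan.step[OF step.IH step.hyps(2)]) (auto simp: less_Suc_eq)
  qed
  fix y
  assume "y \<in> {y. y N \<in> R \<and> (\<lambda>s. y s + y N * deriv g w s) \<in> relation_module N g}"
  then have yN: "y N \<in> R" and y: "(\<lambda>s. y s + y N * deriv g w s)(N := 0) \<in> lspan R (Suc N) (?X (Suc N))"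
    using incl by (auto simp: relation_module_def)
  have ws: "[(N, True)] \<in> words (Suc N)" "word_inv w \<in> words (Suc N)"
    using words_mono[of N "Suc N" w] w(1) by auto
  have gc: "g N \<in> carrier G" using g by auto
  have "word_value G g ([(N, True)] @ word_inv w) = \<one>"
    using word_value_append[OF g ws] word_value_inv[OF gN w(1)] w(2) gc by (simp add: letter_value_def)
  then have mem: "deriv g ([(N, True)] @ word_inv w) \<in> ?X (Suc N)" using ws by auto
  have "deriv g ([(N, True)] @ word_inv w) s = (if s = N then 1 else 0) - deriv g w s" for s
    using deriv_append[OF g ws, of s] deriv_word_inv[OF gN w(1), of s] deriv_generator[of N "Suc N" g s] w(2) g gc
      character_inv(2)[OF gc]
    by (simp add: letter_value_def mult.assoc[symmetric])
  moreover have "deriv g w N = 0" using deriv_outside[OF gN _ w(1)] by simp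
  ultimately show "y \<in> relation_module (Suc N) g"
    unfolding relation_module_def using yN
    by (intro lspan.step[OF y yN mem]) (auto simp: less_Suc_eq)
qed

lemma relation_module_relabel:
  assumes g: "g ` {..<N} \<subseteq> carrier G" and h: "h ` {..<N} \<subseteq> carrier G"
    and \<pi>: "bij_betw \<pi> {..<N} {..<N}" "\<And>s. s < N \<Longrightarrow> h (\<pi> s) = g s"
    and y: "y \<in> relation_module N g"
  shows "(\<lambda>s. y (inv_into {..<N} \<pi> s)) \<in> relation_module N h"
  using y unfolding relation_module_def
proof induction
  case (zero y)
  then show ?case
    using bij_betwE[OF bij_betw_inv_into[OF \<pi>(1)]] by (auto intro!: lspan.zero)
next
  case (step x c u y)
  then obtain u' where u: "u = deriv g u'" and u': "u' \<in> words N" "word_value G g u' = \<one>" by auto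
  let ?\<rho> = "inv_into {..<N} \<pi>"
  have \<rho>: "?\<rho> s < N" if "s < N" for s
    using bij_betwE[OF bij_betw_inv_into[OF \<pi>(1)]] that by auto
  have \<pi>\<rho>: "\<pi> i = s \<longleftrightarrow> i = ?\<rho> s" if "i < N" "s < N" for i s
    using \<pi>(1) that by (metis bij_betw_inv_into_left bij_betw_inv_into_right lessThan_iff)
  define \<sigma> where "\<sigma> i = [(\<pi> i, True)]" for i
  have \<pi>N: "\<pi> i < N" if "i < N" for i using bij_betwE[OF \<pi>(1)] that by auto
  have \<sigma>: "\<sigma> i \<in> words N" "word_value G h (\<sigma> i) = g i" if "i < N" for i
    using \<pi>N[OF that] h \<pi>(2)[OF that] g that by (auto simp: \<sigma>_def letter_value_def image_subset_iff)
  have deriv: "deriv h (subst_word \<sigma> u') s = u (?\<rho> s)" if "s < N" for s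
  proof -
    have "deriv h (subst_word \<sigma> u') s = (\<Sum>i<N. u i * deriv h (\<sigma> i) s)"
      unfolding u by (rule deriv_subst[OF h g \<sigma> u'(1)])
    also have "\<dots> = (\<Sum>i<N. if i = ?\<rho> s then u (?\<rho> s) else 0)"
      by (rule sum.cong) (auto simp: \<sigma>_def deriv_generator[OF _ h] \<pi>N \<pi>\<rho>[OF _ that] if_distrib cong: if_cong)
    finally show ?thesis using \<rho>[OF that] by simp
  qed
  have "deriv h (subst_word \<sigma> u') \<in> {deriv h w | w. w \<in> words N \<and> word_value G h w = \<one>}"
    using subst_word_words[OF u'(1) \<sigma>(1)] word_value_subst[OF h g \<sigma> u'(1)] u'(2) by auto
  then show ?case
    by (rule lspan.step[OF step.IH step.hyps(2)]) (simp add: deriv step.hyps(4) \<rho>)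
qed

lemma dets_relation_module_relabel:
  assumes g: "g ` {..<N} \<subseteq> carrier G" and h: "h ` {..<N} \<subseteq> carrier G"
    and \<pi>: "bij_betw \<pi> {..<N} {..<N}" "\<And>s. s < N \<Longrightarrow> h (\<pi> s) = g s"
  shows "dets R d N (relation_module N g) = dets R d N (relation_module N h)"
proof
  show "dets R d N (relation_module N g) \<subseteq> dets R d N (relation_module N h)"
    by (rule dets_relabel[OF bij_betw_inv_into[OF \<pi>(1)]]) (rule relation_module_relabel[OF g h \<pi>])
  let ?\<rho> = "inv_into {..<N} \<pi>"
  have \<rho>: "bij_betw ?\<rho> {..<N} {..<N}" by (rule bij_betw_inv_into[OF \<pi>(1)])
  have "g (?\<rho> s) = h s" if "s < N" for s
    using \<pi>(2)[of "?\<rho> s"] bij_betwE[OF \<rho>] bij_betw_inv_into_right[OF \<pi>(1)] that by auto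
  then show "dets R d N (relation_module N h) \<subseteq> dets R d N (relation_module N g)"
    by (intro dets_relabel[OF bij_betw_inv_into[OF \<rho>]]) (rule relation_module_relabel[OF h g \<rho>])
qed

lemma dets_relation_module_extend:
  assumes J: "ideal_over R J" and gen: "carrier G \<subseteq> word_value G g ` words N"
  shows "g ` {..<N + n} \<subseteq> carrier G \<Longrightarrow>
    dets R (N + n - k) (N + n) (relation_module (N + n) g) \<subseteq> J \<longleftrightarrow>
    dets R (N - k) N (relation_module N g) \<subseteq> J"
proof (induction n)
  case (Suc n)
  let ?M = "N + n"
  have gM: "g ` {..<?M} \<subseteq> carrier G" and gS: "g ` {..<Suc ?M} \<subseteq> carrier G" and gc: "g ?M \<in> carrier G"
    using Suc.prems by auto
  obtain w where w: "w \<in> words N" "word_value G g w = g ?M" using gen gc by auto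
  have w': "w \<in> words ?M" using words_mono[OF _ w(1)] by simp
  \<comment> \<open>For \<open>k > N + n\<close> both sides are about the empty determinant 1.\<close>
  have "dets R (Suc ?M - k) (Suc ?M) (relation_module (Suc ?M) g) \<subseteq> J \<longleftrightarrow>
    dets R (?M - k) ?M (relation_module ?M g) \<subseteq> J"
  proof (cases "k \<le> ?M")
    case True
    then have "Suc ?M - k = Suc (?M - k)" by simp
    then show ?thesis
      unfolding relation_module_extend[OF gS w' w(2)]
      by (simp only: relation_module_def, intro dets_extend[OF J])
        (use deriv_mem[OF gM] w' in auto)
  next
    case False
    then show ?thesis by (simp add: dets_def pairing_det_def)
  qed
  then show ?case using Suc.IH[OF gM] by simp
qed simp

lemma bij_betw_swap_blocks:
  "bij_betw (\<lambda>s. if s < N then s + M else s - N) {..<N + M} {..<N + (M :: nat)}"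
  by (rule bij_betwI[where g = "\<lambda>s. if s < M then s + N else s - M"]) auto

text \<open>Both tuples extend to their concatenation by redundant generators, in the two possible
  orders, which differ by a relabelling of the coordinates.\<close>

lemma dets_relation_module_independent:
  assumes J: "ideal_over R J"
    and g: "g ` {..<N} \<subseteq> carrier G" "carrier G \<subseteq> word_value G g ` words N"
    and h: "h ` {..<M} \<subseteq> carrier G" "carrier G \<subseteq> word_value G h ` words M"
  shows "dets R (N - k) N (relation_module N g) \<subseteq> J \<longleftrightarrow> dets R (M - k) M (relation_module M h) \<subseteq> J"
proof -
  define join where "join p N q = (\<lambda>s. if s < N then p s else q (s - N))" for p q :: "nat \<Rightarrow> 'a" and N
  have ext: "dets R (N + M - k) (N + M) (relation_module (N + M) (join g N h)) \<subseteq> J \<longleftrightarrow>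
      dets R (N - k) N (relation_module N g) \<subseteq> J"
    and join_carrier: "join g N h ` {..<N + M} \<subseteq> carrier G"
    if g: "g ` {..<N} \<subseteq> carrier G" "carrier G \<subseteq> word_value G g ` words N" and h: "h ` {..<M} \<subseteq> carrier G"
    for g h N M
  proof -
    have eq: "join g N h s = g s" if "s < N" for s using that by (simp add: join_def)
    show car: "join g N h ` {..<N + M} \<subseteq> carrier G"
      using g h by (auto simp: join_def image_subset_iff)
    then have carN: "join g N h ` {..<N} \<subseteq> carrier G" by auto
    have "word_value G (join g N h) ` words N = word_value G g ` words N"
      by (rule image_cong[OF refl], rule word_value_cong) (use eq in auto)
    then have "dets R (N + M - k) (N + M) (relation_module (N + M) (join g N h)) \<subseteq> J \<longleftrightarrow>
        dets R (N - k) N (relation_module N (join g N h)) \<subseteq> J"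
      using g(2) by (intro dets_relation_module_extend[OF J _ car]) simp
    also have "dets R (N - k) N (relation_module N (join g N h)) = dets R (N - k) N (relation_module N g)"
      by (rule dets_relation_module_relabel[OF carN g(1), of id]) (auto simp: eq)
    finally show "dets R (N + M - k) (N + M) (relation_module (N + M) (join g N h)) \<subseteq> J \<longleftrightarrow>
      dets R (N - k) N (relation_module N g) \<subseteq> J" .
  qed
  have "dets R (N + M - k) (N + M) (relation_module (N + M) (join g N h)) =
      dets R (N + M - k) (N + M) (relation_module (N + M) (join h M g))"
    by (rule dets_relation_module_relabel[OF join_carrier[OF g h(1)] _ bij_betw_swap_blocks])
      (use join_carrier[OF h g(1)] in \<open>auto simp: join_def add.commute\<close>)
  then show ?thesis
    using ext[OF g h(1)] ext[OF h g(1)] by (simp add: add.commute)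
qed

lemma elementary_minors_independent:
  assumes J: "ideal_over R J" and "presents G N rs g" "presents G M rs' h"
  shows "minors (mat (length rs) N (\<lambda>(i, j). deriv g (rs ! i) j)) (N - k) \<subseteq> J \<longleftrightarrow>
    dets R (M - k) M (relation_module M h) \<subseteq> J"
proof -
  have "minors (mat (length rs) N (\<lambda>(i, j). deriv g (rs ! i) j)) (N - k) \<subseteq> J \<longleftrightarrow>
      dets R (N - k) N (relation_module N g) \<subseteq> J"
    unfolding relation_module_presents[OF assms(2)] by (rule minors_subset_iff[OF J]) simp
  also have "\<dots> \<longleftrightarrow> dets R (M - k) M (relation_module M h) \<subseteq> J"
    by (rule dets_relation_module_independent[OF J]) (use assms(2,3) in \<open>auto simp: presents_def\<close>)
  finally show ?thesis .
qed

end

section \<open>The polynomials in one variable\<close>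

definition geometric :: "nat \<Rightarrow> nat \<Rightarrow> rat poly" where
  "geometric d k = (\<Sum>i<k. Polynomial.monom 1 (d * i))"

lemma U_poly_mult: "U_poly (d * k) = U_poly d * geometric d k"
  using power_diff_1_eq[of "Polynomial.monom (1::rat) d" k]
  by (simp add: U_poly_def geometric_def monom_power)

lemma U_poly_monic:
  assumes "0 < d"
  shows "degree (U_poly d) = d" "poly.coeff (U_poly d) d = 1"
proof -
  have "degree (- 1 :: rat poly) < degree (Polynomial.monom (1::rat) d)"
    using assms by (simp add: degree_monom_eq)
  then show "degree (U_poly d) = d"
    using degree_add_eq_left[of "- 1 :: rat poly" "Polynomial.monom 1 d"]
    by (simp add: U_poly_def degree_monom_eq)
  show "poly.coeff (U_poly d) d = 1"
    using assms by (simp add: U_poly_def)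
qed

lemma coeff_U_poly_0: "0 < d \<Longrightarrow> poly.coeff (U_poly d) 0 = - 1"
  by (simp add: U_poly_def)

lemma U_poly_nonzero: "0 < d \<Longrightarrow> U_poly d \<noteq> 0"
  using U_poly_monic(2)[of d] by auto

lemma A_poly_eq: "0 < m \<Longrightarrow> A_poly m n = geometric m n"
  by (simp add: A_poly_def U_poly_mult U_poly_nonzero)

lemma B_poly_eq: "0 < n \<Longrightarrow> B_poly m n = geometric n m"
  by (simp add: B_poly_def U_poly_mult[of n m, unfolded mult.commute[of n m]] U_poly_nonzero)

lemma U_poly_factor:
  assumes "0 < m" "0 < n"
  shows "U_poly (m * n) = A_poly m n * U_poly m" "U_poly (m * n) = B_poly m n * U_poly n"
  using U_poly_mult[of m n] U_poly_mult[of n m] assms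
  by (simp_all add: A_poly_eq B_poly_eq mult.commute)

text \<open>If \<open>m r = n s + 1\<close>, then \<open>X\<^sup>m\<^sup>r - 1 = X (X\<^sup>n\<^sup>s - 1) + (X - 1)\<close>.\<close>

lemma U_poly_bezout:
  assumes "0 < m" "coprime m n"
  obtains x y where "x * U_poly m + y * U_poly n = U_poly 1"
proof -
  obtain r s where rs: "m * r = n * s + 1"
    using bezout_nat[of m n] assms by (auto simp: coprime_iff_gcd_eq_1)
  have "U_poly (n * s + 1) = Polynomial.monom 1 1 * U_poly (n * s) + U_poly 1"
    by (simp add: U_poly_def algebra_simps mult_monom)
  then have "geometric m r * U_poly m + (- Polynomial.monom 1 1 * geometric n s) * U_poly n = U_poly 1"
    unfolding rs[symmetric] U_poly_mult by (simp add: algebra_simps)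
  then show ?thesis by (rule that)
qed

lemma AB_monic:
  assumes "0 < m" "0 < n"
  shows "lead_coeff (A_poly m n) = 1" "lead_coeff (B_poly m n) = 1"
    and "poly.coeff (A_poly m n) 0 \<noteq> 0" "poly.coeff (B_poly m n) 0 \<noteq> 0"
  using U_poly_factor[OF assms, THEN arg_cong[of _ _ lead_coeff]]
    U_poly_factor[OF assms, THEN arg_cong[of _ _ "\<lambda>p. poly.coeff p 0"]] assms
  by (auto simp: lead_coeff_mult U_poly_monic coeff_U_poly_0 coeff_mult_0)

lemma normalize_monic: "lead_coeff (p :: rat poly) = 1 \<Longrightarrow> normalize p = p"
  by (simp add: normalize_poly_def one_pCons[symmetric])

lemma gcd_U_poly:
  assumes "0 < m" "coprime m n"
  shows "gcd (U_poly m) (U_poly n) = U_poly 1"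
proof (rule gcdI[symmetric])
  show "U_poly 1 dvd U_poly m" "U_poly 1 dvd U_poly n"
    using U_poly_mult[of 1 m] U_poly_mult[of 1 n] by simp_all
  show "d dvd U_poly 1" if "d dvd U_poly m" "d dvd U_poly n" for d
    using U_poly_bezout[OF assms] that by (metis dvd_add dvd_mult)
  show "normalize (U_poly 1) = U_poly 1"
    by (rule normalize_monic) (simp add: U_poly_monic)
qed

text \<open>Since \<open>D = A a = B b\<close> for \<open>a = X\<^sup>m - 1\<close> and \<open>b = X\<^sup>n - 1\<close>, multiplying \<open>gcd(A, B)\<close> by \<open>a b\<close> gives
  \<open>gcd(D b, D a) = D gcd(a, b)\<close>; all polynomials involved are monic, so no units intervene.\<close>

lemma gcd_AB_identity:
  assumes "0 < m" "0 < n" "coprime m n"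
  shows "gcd (A_poly m n) (B_poly m n) * (U_poly m * U_poly n) = U_poly (m * n) * U_poly 1"
proof -
  let ?D = "U_poly (m * n)" and ?a = "U_poly m" and ?b = "U_poly n"
  have norm: "normalize (?a * ?b) = ?a * ?b" "normalize ?D = ?D"
    using assms by (auto intro!: normalize_monic simp: lead_coeff_mult U_poly_monic)
  have "gcd (A_poly m n) (B_poly m n) * (?a * ?b) = gcd (?a * ?b * A_poly m n) (?a * ?b * B_poly m n)"
    by (simp only: gcd_mult_left normalize_mult[of "?a * ?b"] norm normalize_gcd mult.commute[of _ "?a * ?b"])
  also have "?a * ?b * A_poly m n = ?D * ?b"
    using U_poly_factor(1)[OF assms(1,2)] by (simp add: algebra_simps)
  also have "?a * ?b * B_poly m n = ?D * ?a"
    using U_poly_factor(2)[OF assms(1,2)] by (simp add: algebra_simps)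
  also have "gcd (?D * ?b) (?D * ?a) = ?D * gcd ?a ?b"
    by (simp only: gcd_mult_left normalize_mult[of ?D] norm normalize_gcd gcd.commute)
  finally show ?thesis using gcd_U_poly[OF assms(1,3)] by simp
qed

lemma P_poly_monic:
  assumes "0 < m" "0 < n"
  shows "lead_coeff (P_poly l m n k) = 1" "poly.coeff (P_poly l m n k) 0 \<noteq> 0"
proof -
  let ?A = "A_poly m n" and ?B = "B_poly m n"
  have g: "?A \<noteq> 0" using AB_monic(1)[OF assms] by auto
  then have "unit_factor (gcd ?A ?B) = 1" by (simp add: unit_factor_gcd)
  then have "[:lead_coeff (gcd ?A ?B):] = 1" by (simp add: unit_factor_poly_def monom_0)
  then have g1: "lead_coeff (gcd ?A ?B) = 1" by (simp add: one_pCons)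
  obtain h where "?A = gcd ?A ?B * h" by (metis dvd_def gcd_dvd1)
  then have "poly.coeff (gcd ?A ?B) 0 * poly.coeff h 0 = poly.coeff ?A 0" by (metis coeff_mult_0)
  then have g0: "poly.coeff (gcd ?A ?B) 0 \<noteq> 0" using AB_monic(3)[OF assms] by auto
  show "lead_coeff (P_poly l m n k) = 1"
    using g1 assms by (simp add: P_poly_def lead_coeff_mult lead_coeff_power AB_monic U_poly_monic)
  show "poly.coeff (P_poly l m n k) 0 \<noteq> 0"
    using g0 assms by (simp add: P_poly_def coeff_mult_0 coeff_0_power AB_monic coeff_U_poly_0)
qed

section \<open>Evaluation at the product of the variables\<close>

text \<open>The exponent of \<open>t\<^sub>1 \<dots> t\<^sub>l\<close>; for \<open>l\<close> smaller than the number of variables it is the value of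
  \<open>\<phi>\<close> at the generator \<open>f\<^sub>l\<close> of the link group.\<close>

definition prefix_vec :: "nat \<Rightarrow> exponent" where
  "prefix_vec l = (\<Sum>i = 1..l. basis_vec i)"

lemma t_monom_add: "t_monom (d + e) = t_monom d * t_monom e"
  by (simp add: t_monom_def mult_single)

lemma t_monom_0 [simp]: "t_monom 0 = 1"
  by (simp add: t_monom_def)

lemma t_monom_sum: "t_monom (sum f S) = (\<Prod>i\<in>S. t_monom (f i))"
  by (induction S rule: infinite_finite_induct) (simp_all add: t_monom_add)

lemma at_U_pCons: "at_U l (pCons a p) = Poly_Mapping.single 0 a + t_monom (prefix_vec l) * at_U l p"
  by (simp add: at_U_def map_poly_pCons prefix_vec_def t_monom_sum t_var_def)

lemma at_U_0 [simp]: "at_U l 0 = 0"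
  by (simp add: at_U_def)

lemma at_U_add: "at_U l (p + q) = at_U l p + at_U l q"
  by (induction p q rule: poly_induct2) (simp_all add: at_U_pCons single_add algebra_simps)

lemma at_U_smult: "at_U l (Polynomial.smult a p) = Poly_Mapping.single 0 a * at_U l p"
  by (induction p) (simp_all add: at_U_pCons algebra_simps mult_single)

lemma at_U_mult: "at_U l (p * q) = at_U l p * at_U l q"
  by (induction p) (simp_all add: at_U_pCons at_U_add at_U_smult algebra_simps)

lemma at_U_1 [simp]: "at_U l 1 = 1"
  by (simp add: one_pCons at_U_pCons)

lemma at_U_uminus: "at_U l (- p) = - at_U l p"
  using at_U_add[of l p "- p"] by (simp add: eq_neg_iff_add_eq_0 add.commute)

lemma at_U_diff: "at_U l (p - q) = at_U l p - at_U l q"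
  using at_U_add[of l p "- q"] by (simp add: at_U_uminus)

lemma at_U_sum: "at_U l (sum f S) = (\<Sum>i\<in>S. at_U l (f i))"
  by (induction S rule: infinite_finite_induct) (simp_all add: at_U_add)

lemma at_U_power: "at_U l (p ^ k) = at_U l p ^ k"
  by (induction k) (simp_all add: at_U_mult)

lemma at_U_monom: "at_U l (Polynomial.monom 1 j) = t_monom (prefix_vec l) ^ j"
  by (induction j) (simp_all add: monom_0 monom_Suc at_U_pCons)

lemma lookup_t_monom_mult: "Poly_Mapping.lookup (t_monom d * f) e = Poly_Mapping.lookup f (e - d)"
proof -
  have "(e = d + q) = (q = e - d)" for q by auto
  then show ?thesis
    by (simp add: t_monom_def times_poly_mapping.rep_eq prod_fun_def lookup_single when_mult)
qed

section \<open>Reduced Groebner bases\<close>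

abbreviation lk where "lk \<equiv> Poly_Mapping.lookup"

lemma monom_dvd_trans: "monom_dvd d e \<Longrightarrow> monom_dvd e f \<Longrightarrow> monom_dvd d f"
  unfolding monom_dvd_def by (meson order_trans)

lemma monom_dvd_antisym: "monom_dvd d e \<Longrightarrow> monom_dvd e d \<Longrightarrow> d = e"
  unfolding monom_dvd_def by (intro poly_mapping_eqI) (simp add: order_antisym)

lemma monom_dvd_imp_le:
  assumes "monom_dvd d e"
  shows "d \<le> e"
proof (rule ccontr)
  assume "\<not> d \<le> e"
  then have "less_fun (lk e) (lk d)" by (simp add: not_le less_poly_mapping.rep_eq)
  then obtain k where "lk e k < lk d k" unfolding less_fun_def by blast
  then show False using assms by (meson monom_dvd_def not_le)
qed

lemma lead_monom_in_keys: "f \<noteq> 0 \<Longrightarrow> lead_monom f \<in> Poly_Mapping.keys f"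
  unfolding lead_monom_def by (rule Max_in) auto

lemma le_lead_monom: "e \<in> Poly_Mapping.keys f \<Longrightarrow> e \<le> lead_monom f"
  unfolding lead_monom_def by (rule Max_ge) auto

lemma lead_monom_eqI: "lk f e \<noteq> 0 \<Longrightarrow> (\<And>d. e < d \<Longrightarrow> lk f d = 0) \<Longrightarrow> lead_monom f = e"
  unfolding lead_monom_def by (rule Max_eqI) (auto simp: in_keys_iff not_less[symmetric])

text \<open>Reducedness forces each element of \<open>B\<close> to have a partner in \<open>C\<close> with the same leading
  monomial. Their difference lies in \<open>I\<close>, and its leading monomial is a non-leading monomial of
  one of the two, so no leading monomial of the corresponding basis can divide it unless the
  difference is 0.\<close>

lemma reduced_groebner_basis_subset:
  assumes diff: "\<And>f g. f \<in> I \<Longrightarrow> g \<in> I \<Longrightarrow> f - g \<in> I"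
    and B: "reduced_groebner_basis I B" and C: "reduced_groebner_basis I C"
  shows "B \<subseteq> C"
proof
  fix g assume g: "g \<in> B"
  have red: "p = q" if "reduced_groebner_basis I D" "p \<in> D" "q \<in> D" "e \<in> Poly_Mapping.keys p" "monom_dvd (lead_monom q) e"
    for D p q e
    using that unfolding reduced_groebner_basis_def by blast
  have monic: "lk p (lead_monom p) = 1" and mem: "p \<in> I" and nz: "p \<noteq> 0"
    if "reduced_groebner_basis I D" "p \<in> D" for D p
    using that unfolding reduced_groebner_basis_def by auto
  have div: "\<exists>p \<in> D. monom_dvd (lead_monom p) (lead_monom f)"
    if "reduced_groebner_basis I D" "f \<in> I" "f \<noteq> 0" for D f
    using that unfolding reduced_groebner_basis_def by auto
  obtain h where h: "h \<in> C" "monom_dvd (lead_monom h) (lead_monom g)"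
    using div[OF C mem[OF B g] nz[OF B g]] by auto
  obtain g' where g': "g' \<in> B" "monom_dvd (lead_monom g') (lead_monom h)"
    using div[OF B mem[OF C h(1)] nz[OF C h(1)]] by auto
  have "g = g'"
    using red[OF B g g'(1) lead_monom_in_keys[OF nz[OF B g]]] monom_dvd_trans[OF g'(2) h(2)] by simp
  then have lm: "lead_monom g = lead_monom h" using g'(2) h(2) by (auto intro: monom_dvd_antisym)
  show "g \<in> C"
  proof (rule ccontr)
    assume "g \<notin> C"
    then have f0: "g - h \<noteq> 0" using h(1) by auto
    let ?e = "lead_monom (g - h)"
    have e: "lk (g - h) ?e \<noteq> 0" using lead_monom_in_keys[OF f0] by (simp add: in_keys_iff)
    then have ne: "?e \<noteq> lead_monom g"
      using monic[OF B g] monic[OF C h(1)] lm by (auto simp: lookup_minus)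
    have f: "g - h \<in> I" using diff mem[OF B g] mem[OF C h(1)] .
    consider "?e \<in> Poly_Mapping.keys g" | "?e \<in> Poly_Mapping.keys h"
      using e by (force simp: in_keys_iff lookup_minus)
    then show False
    proof cases
      case 1
      obtain p where p: "p \<in> B" "monom_dvd (lead_monom p) ?e" using div[OF B f f0] by auto
      then have "p = g" using red[OF B g p(1) 1] by simp
      then have "lead_monom g \<le> ?e" using p monom_dvd_imp_le by simp
      then show False using le_lead_monom[OF 1] ne by simp
    next
      case 2
      obtain p where p: "p \<in> C" "monom_dvd (lead_monom p) ?e" using div[OF C f f0] by auto
      then have "p = h" using red[OF C h(1) p(1) 2] by simp
      then have "lead_monom h \<le> ?e" using p monom_dvd_imp_le by simp
      then show False using le_lead_monom[OF 2] ne lm by simp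
    qed
  qed
qed

lemma reduced_groebner_basis_unique:
  assumes "\<And>f g. f \<in> I \<Longrightarrow> g \<in> I \<Longrightarrow> f - g \<in> I" "reduced_groebner_basis I B"
  shows "(THE B. reduced_groebner_basis I B) = B"
proof (rule the_equality)
  show "C = B" if "reduced_groebner_basis I C" for C
    using reduced_groebner_basis_subset[OF assms(1) that assms(2)]
      reduced_groebner_basis_subset[OF assms(1) assms(2) that] by simp
qed (rule assms(2))

section \<open>Multiples of a polynomial in the product of the variables\<close>

lemma lookup_prefix_vec: "lk (prefix_vec l) i = (if i \<in> {1..l} then 1 else 0)"
  by (simp add: prefix_vec_def lookup_sum basis_vec_def lookup_single when_def)

lemma lookup_single_0_mult: "lk (Poly_Mapping.single 0 a * f) e = a * lk f e"
  by (simp add: mult_map_scale_conv_mult[symmetric] Poly_Mapping.map.rep_eq when_def)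

lemma t_monom_power: "t_monom d ^ j = t_monom (frag_cmul (int j) d)"
proof (induction j)
  case (Suc j)
  have "frag_cmul (int (Suc j)) d = d + frag_cmul (int j) d"
    by (simp add: frag_cmul_distrib)
  then show ?case using Suc by (simp add: t_monom_add)
qed simp

abbreviation u_pow :: "nat \<Rightarrow> nat \<Rightarrow> exponent" where
  "u_pow l j \<equiv> frag_cmul (int j) (prefix_vec l)"

lemma lookup_at_U_mult: "lk (at_U l p * f) e = (\<Sum>j\<le>degree p. poly.coeff p j * lk f (e - u_pow l j))"
proof -
  have "at_U l p = at_U l (\<Sum>j\<le>degree p. Polynomial.smult (poly.coeff p j) (Polynomial.monom 1 j))"
    by (simp add: smult_monom poly_as_sum_of_monoms)
  also have "\<dots> = (\<Sum>j\<le>degree p. Poly_Mapping.single 0 (poly.coeff p j) * t_monom (u_pow l j))"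
    by (simp add: at_U_sum at_U_smult at_U_monom t_monom_power)
  finally show ?thesis
    by (simp add: sum_distrib_right lookup_sum mult.assoc lookup_single_0_mult lookup_t_monom_mult)
qed

lemma u_pow_mono: "i \<le> j \<Longrightarrow> u_pow l i \<le> u_pow l j"
  by (rule monom_dvd_imp_le) (simp add: monom_dvd_def lookup_prefix_vec)

lemma u_pow_strict_mono:
  assumes "1 \<le> l" "i < j"
  shows "u_pow l i < u_pow l j"
proof -
  have "lk (u_pow l i) 1 \<noteq> lk (u_pow l j) 1" using assms by (simp add: lookup_prefix_vec)
  then show ?thesis using u_pow_mono[of i j l] assms(2) by (metis less_imp_le_nat order_less_le)
qed

text \<open>The top coefficient of \<open>p\<close> and the leading monomial of \<open>h\<close> produce the largest exponent
  and do so in only one way.\<close>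

lemma lookup_lead_at_U_mult:
  assumes "1 \<le> l"
  shows "lk (at_U l p * h) (u_pow l (degree p) + lead_monom h) = lead_coeff p * lk h (lead_monom h)"
    and "u_pow l (degree p) + lead_monom h < e \<Longrightarrow> lk (at_U l p * h) e = 0"
proof -
  have zero: "lk h e = 0" if "lead_monom h < e" for e
    using le_lead_monom[of e h] that by (auto simp: in_keys_iff not_less[symmetric])
  have "lk h (u_pow l (degree p) + lead_monom h - u_pow l j) = 0" if "j < degree p" for j
    by (rule zero) (use u_pow_strict_mono[OF assms that] in \<open>simp add: less_diff_eq add.commute\<close>)
  then have "(\<Sum>j\<le>degree p. poly.coeff p j * lk h (u_pow l (degree p) + lead_monom h - u_pow l j)) =
      (\<Sum>j\<le>degree p. if j = degree p then lead_coeff p * lk h (lead_monom h) else 0)"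
    by (intro sum.cong) auto
  then show "lk (at_U l p * h) (u_pow l (degree p) + lead_monom h) = lead_coeff p * lk h (lead_monom h)"
    by (simp add: lookup_at_U_mult)
  assume e: "u_pow l (degree p) + lead_monom h < e"
  have "lead_monom h < e - u_pow l j" if "j \<le> degree p" for j
  proof -
    have "lead_monom h + u_pow l j \<le> u_pow l (degree p) + lead_monom h"
      using u_pow_mono[OF that, of l] by (simp add: add.commute)
    then show ?thesis using e by (metis less_diff_eq order_le_less_trans)
  qed
  then show "lk (at_U l p * h) e = 0"
    unfolding lookup_at_U_mult by (intro sum.neutral) (simp add: zero)
qed

lemma lead_monom_at_U_mult:
  assumes "1 \<le> l" "p \<noteq> 0" "h \<noteq> 0"
  shows "lead_monom (at_U l p * h) = u_pow l (degree p) + lead_monom h"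
proof (rule lead_monom_eqI)
  show "lk (at_U l p * h) (u_pow l (degree p) + lead_monom h) \<noteq> 0"
    unfolding lookup_lead_at_U_mult(1)[OF assms(1)]
    using lead_monom_in_keys[OF assms(3)] assms(2) by (auto simp: in_keys_iff)
qed (rule lookup_lead_at_U_mult(2)[OF assms(1)])

lemma keys_at_U_mult:
  assumes "e \<in> Poly_Mapping.keys (at_U l p * f)"
  obtains j d where "j \<le> degree p" "d \<in> Poly_Mapping.keys f" "e = u_pow l j + d"
proof -
  have "(\<Sum>j\<le>degree p. poly.coeff p j * lk f (e - u_pow l j)) \<noteq> 0"
    using assms by (simp add: in_keys_iff lookup_at_U_mult)
  then obtain j where "j \<le> degree p" "lk f (e - u_pow l j) \<noteq> 0"
    by (metis (no_types, lifting) atMost_iff mult_zero_right sum.neutral)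
  then show ?thesis by (intro that[of j "e - u_pow l j"]) (auto simp: in_keys_iff)
qed

lemma mem_polynomials:
  "f \<in> polynomials l \<longleftrightarrow>
    (\<forall>e \<in> Poly_Mapping.keys f. (\<forall>i. i \<notin> {1..l} \<longrightarrow> lk e i = 0) \<and> (\<forall>i. 0 \<le> lk e i))"
  by (auto simp: polynomials_def laurent_ring_def Z_lattice_def in_keys_iff subset_iff)

lemma at_U_mult_polynomials:
  assumes "f \<in> polynomials l"
  shows "at_U l p * f \<in> polynomials l"
  unfolding mem_polynomials
proof
  fix e assume "e \<in> Poly_Mapping.keys (at_U l p * f)"
  then obtain j d where "j \<le> degree p" "d \<in> Poly_Mapping.keys f" "e = u_pow l j + d"
    by (rule keys_at_U_mult)
  then show "(\<forall>i. i \<notin> {1..l} \<longrightarrow> lk e i = 0) \<and> (\<forall>i. 0 \<le> lk e i)"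
    using assms by (auto simp: mem_polynomials lookup_add lookup_prefix_vec)
qed

text \<open>Among the monomials of the cofactor that agree with \<open>e\<close> outside the variables of \<open>U\<close>, one
  with the least exponent of \<open>t\<^sub>i\<close> survives in the product: only the constant term of \<open>p\<close>
  reaches it.\<close>

lemma cofactor_extremal_key:
  assumes p: "poly.coeff p 0 \<noteq> 0" and e: "e \<in> Poly_Mapping.keys h" and i: "i \<in> {1..l}"
  obtains d where "d \<in> Poly_Mapping.keys (at_U l p * h)" "lk d i \<le> lk e i"
    "\<And>k. k \<notin> {1..l} \<Longrightarrow> lk d k = lk e k"
proof -
  define K where "K = {d \<in> Poly_Mapping.keys h. \<forall>k. k \<notin> {1..l} \<longrightarrow> lk d k = lk e k}"
  let ?S = "(\<lambda>d. lk d i) ` K"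
  have S: "finite ?S" "?S \<noteq> {}" and eK: "e \<in> K" using e by (auto simp: K_def)
  from Min_in[OF S] obtain d where d: "d \<in> K" "lk d i = Min ?S" by (metis imageE)
  have min: "lk d i \<le> lk c i" if "c \<in> K" for c
    using Min_le[OF S(1)] that d(2) by auto
  have "lk h (d - u_pow l j) = 0" if "0 < j" for j
  proof (rule ccontr)
    assume "lk h (d - u_pow l j) \<noteq> 0"
    then have "d - u_pow l j \<in> K"
      using d(1) by (auto simp: K_def in_keys_iff lookup_minus lookup_prefix_vec)
    then have "lk d i \<le> lk (d - u_pow l j) i" by (rule min)
    then show False using i that by (simp add: lookup_minus lookup_prefix_vec)
  qed
  then have "lk (at_U l p * h) d = (\<Sum>j\<le>degree p. if j = 0 then poly.coeff p 0 * lk h d else 0)"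
    unfolding lookup_at_U_mult by (intro sum.cong) auto
  then have "d \<in> Poly_Mapping.keys (at_U l p * h)"
    using p d(1) by (simp add: K_def in_keys_iff)
  then show ?thesis using that min[OF eK] d(1) by (auto simp: K_def)
qed

text \<open>Were an exponent of \<open>t\<^sub>i\<close> in \<open>h\<close> negative, or did a variable other than \<open>t\<^sub>1, \<dots>, t\<^sub>l\<close> occur,
  then the surviving monomial would exhibit this in the product.\<close>

lemma cofactor_polynomials:
  assumes l: "1 \<le> l" and p: "poly.coeff p 0 \<noteq> 0" and f: "at_U l p * h \<in> polynomials l"
  shows "h \<in> polynomials l"
  unfolding mem_polynomials
proof (intro ballI conjI allI impI)
  fix e i assume e: "e \<in> Poly_Mapping.keys h"
  show out: "lk e i = 0" if "i \<notin> {1..l}" for i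
    using cofactor_extremal_key[OF p e, of 1 l] f l that by (metis atLeastAtMost_iff le_refl mem_polynomials)
  show "0 \<le> lk e i"
  proof (cases "i \<in> {1..l}")
    case True
    then obtain d where "d \<in> Poly_Mapping.keys (at_U l p * h)" "lk d i \<le> lk e i"
      using cofactor_extremal_key[OF p e True] by blast
    then show ?thesis using f by (meson mem_polynomials order_trans)
  qed (use out in simp)
qed

section \<open>Augmentation\<close>

text \<open>The evaluation at \<open>t\<^sub>1 = t\<^sub>2 = \<dots> = 1\<close>.\<close>

definition augmentation :: "laurent \<Rightarrow> rat" where
  "augmentation f = (\<Sum>e \<in> Poly_Mapping.keys f. lk f e)"

lemma augmentation_add: "augmentation (f + g) = augmentation f + augmentation g"
  unfolding augmentation_def by (rule setsum_keys_plus_distrib) auto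

lemma augmentation_single [simp]: "augmentation (Poly_Mapping.single e a) = a"
  by (simp add: augmentation_def)

lemma augmentation_0 [simp]: "augmentation 0 = 0"
  by (simp add: augmentation_def)

lemma laurent_induct:
  assumes "P 0" "\<And>f e a. P f \<Longrightarrow> P (f + Poly_Mapping.single e a)"
  shows "P (f :: laurent)"
proof (induction f rule: update_induct)
  case (update f e a)
  have "Poly_Mapping.update e a f = f + Poly_Mapping.single e a"
    using update by (intro poly_mapping_eqI)
      (auto simp: lookup_update lookup_add lookup_single in_keys_iff when_def)
  then show ?case using assms(2) update by simp
qed (rule assms(1))

lemma augmentation_mult: "augmentation (f * g) = augmentation f * augmentation g"
proof (induction f rule: laurent_induct)
  case (2 f e a)
  have "augmentation (Poly_Mapping.single e a * g) = a * augmentation g"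
    by (induction g rule: laurent_induct) (simp_all add: mult_single augmentation_add algebra_simps)
  with 2 show ?case by (simp add: augmentation_add algebra_simps)
qed simp

lemma augmentation_hom: "comm_ring_hom augmentation"
  by unfold_locales (simp_all add: augmentation_add augmentation_mult flip: single_one)

lemma augmentation_t_monom [simp]: "augmentation (t_monom e) = 1"
  by (simp add: t_monom_def)

lemma keys_t_var_minus_1: "Poly_Mapping.keys (t_var i - 1) = {basis_vec i, 0}"
proof -
  have "basis_vec i \<noteq> 0" by (simp add: basis_vec_def)
  then have "lk (t_var i - 1) e \<noteq> 0 \<longleftrightarrow> e = basis_vec i \<or> e = 0" for e
    by (auto simp: t_var_def t_monom_def lookup_minus lookup_single lookup_one when_def)
  then show ?thesis by (auto simp: in_keys_iff)
qed

lemma lead_monom_t_var_minus_1: "lead_monom (t_var i - 1) = basis_vec i"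
proof -
  have "0 \<le> basis_vec i" by (rule monom_dvd_imp_le) (simp add: monom_dvd_def basis_vec_def lookup_single when_def)
  then show ?thesis unfolding lead_monom_def keys_t_var_minus_1 by (simp add: max_absorb1)
qed

lemma lookup_basis_vec: "lk (basis_vec i) j = (if i = j then 1 else 0)"
  by (simp add: basis_vec_def lookup_single when_def)

text \<open>The constants are the only polynomials with leading monomial 1, and a nonzero constant has
  nonzero augmentation.\<close>

lemma augmentation_zero_lead_monom:
  assumes h: "h \<noteq> 0" "augmentation h = 0" and nonneg: "\<And>e i. e \<in> Poly_Mapping.keys h \<Longrightarrow> 0 \<le> lk e i"
  shows "lead_monom h \<noteq> 0"
proof
  assume lm: "lead_monom h = 0"
  have "e = 0" if "e \<in> Poly_Mapping.keys h" for e
  proof -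
    have "0 \<le> e" by (rule monom_dvd_imp_le) (use nonneg[OF that] in \<open>simp add: monom_dvd_def\<close>)
    then show ?thesis using le_lead_monom[OF that] lm by simp
  qed
  then have "Poly_Mapping.keys h = {0}" using lead_monom_in_keys[OF h(1)] lm by auto
  then show False using h(2) by (simp add: augmentation_def) (metis in_keys_iff insertI1)
qed

text \<open>A nonzero polynomial \<open>P(U) h\<close> with \<open>h\<close> of augmentation 0 has a leading monomial divisible by \<open>U\<^sup>d t\<^sub>i\<close> for
  some \<open>i\<close>, where \<open>d = deg P\<close>; this is the leading monomial of \<open>P(U) (t\<^sub>i - 1)\<close>. The basis is reduced
  because the exponents of \<open>t\<^sub>j\<close> in \<open>P(U) (t\<^sub>i - 1)\<close> are at most \<open>d\<close> for \<open>j \<noteq> i\<close>.\<close>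

lemma reduced_groebner_basis_augmentation:
  assumes l: "1 \<le> l" and p: "lead_coeff p = 1" "poly.coeff p 0 \<noteq> 0"
    and I: "\<And>f. f \<in> I \<Longrightarrow> f \<in> polynomials l \<and> (\<exists>h. f = at_U l p * h \<and> augmentation h = 0)"
    and gen: "\<And>i. i \<in> {1..l} \<Longrightarrow> at_U l p * (t_var i - 1) \<in> I"
  shows "reduced_groebner_basis I {at_U l p * (t_var i - 1) | i. 1 \<le> i \<and> i \<le> l}"
proof -
  have p0: "p \<noteq> 0" using p(1) by auto
  have tv: "t_var i - 1 \<noteq> 0" for i using keys_t_var_minus_1[of i] by (metis insert_not_empty keys_zero)
  have lm: "lead_monom (at_U l p * (t_var i - 1)) = u_pow l (degree p) + basis_vec i" for i
    using lead_monom_at_U_mult[OF l p0 tv] by (simp add: lead_monom_t_var_minus_1)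
  have monic: "lk (at_U l p * (t_var i - 1)) (u_pow l (degree p) + basis_vec i) = 1" for i
    using lookup_lead_at_U_mult(1)[OF l, of p "t_var i - 1"] p(1)
    by (simp add: lead_monom_t_var_minus_1)
      (auto simp: t_var_def t_monom_def lookup_minus lookup_one lookup_single basis_vec_def when_def)
  have nz: "at_U l p * (t_var i - 1) \<noteq> 0" for i using monic[of i] by auto
  have red: "\<not> monom_dvd (u_pow l (degree p) + basis_vec j) e"
    if "i \<noteq> j" "1 \<le> j" "j \<le> l" "e \<in> Poly_Mapping.keys (at_U l p * (t_var i - 1))" for i j e
  proof
    assume "monom_dvd (u_pow l (degree p) + basis_vec j) e"
    then have "lk (u_pow l (degree p) + basis_vec j) j \<le> lk e j" by (simp add: monom_dvd_def)
    then have "int (degree p) + 1 \<le> lk e j"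
      using \<open>1 \<le> j\<close> \<open>j \<le> l\<close> by (simp add: lookup_add lookup_prefix_vec lookup_basis_vec)
    moreover obtain k d where "k \<le> degree p" "d \<in> Poly_Mapping.keys (t_var i - 1)" "e = u_pow l k + d"
      using keys_at_U_mult[OF \<open>e \<in> _\<close>] .
    ultimately show False
      using \<open>i \<noteq> j\<close> \<open>1 \<le> j\<close> \<open>j \<le> l\<close> by (auto simp: keys_t_var_minus_1 lookup_add lookup_prefix_vec lookup_basis_vec)
  qed
  have div: "\<exists>i. 1 \<le> i \<and> i \<le> l \<and> monom_dvd (u_pow l (degree p) + basis_vec i) (lead_monom f)"
    if f: "f \<in> I" "f \<noteq> 0" for f
  proof -
    obtain h where h: "f = at_U l p * h" "augmentation h = 0" and poly: "f \<in> polynomials l"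
      using I[OF f(1)] by auto
    have h0: "h \<noteq> 0" using f(2) h(1) by auto
    have "h \<in> polynomials l" using cofactor_polynomials[OF l p(2)] poly h(1) by blast
    then have nonneg: "0 \<le> lk e i" if "e \<in> Poly_Mapping.keys h" for e i
      using that unfolding mem_polynomials by blast
    have "lead_monom h \<noteq> 0" by (rule augmentation_zero_lead_monom[OF h0 h(2)]) (rule nonneg)
    then obtain i where i: "lk (lead_monom h) i \<noteq> 0" by (metis lookup_zero poly_mapping_eqI)
    have lmf: "lead_monom f = u_pow l (degree p) + lead_monom h"
      unfolding h(1) by (rule lead_monom_at_U_mult[OF l p0 h0])
    have "i \<in> {1..l}"
    proof (rule ccontr)
      assume out: "i \<notin> {1..l}"
      then have "lk (lead_monom f) i = 0"
        using lead_monom_in_keys[OF f(2)] poly unfolding mem_polynomials by blast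
      then show False using i out by (auto simp: lmf lookup_add lookup_prefix_vec split: if_splits)
    qed
    moreover have "lk (basis_vec i) j \<le> lk (lead_monom h) j" for j
      using i nonneg[OF lead_monom_in_keys[OF h0], of j] by (auto simp: lookup_basis_vec)
    then have "monom_dvd (u_pow l (degree p) + basis_vec i) (lead_monom f)"
      by (simp add: lmf monom_dvd_def lookup_add)
    ultimately show ?thesis by auto
  qed
  let ?B = "{at_U l p * (t_var i - 1) | i. 1 \<le> i \<and> i \<le> l}"
  have B: "?B = (\<lambda>i. at_U l p * (t_var i - 1)) ` {1..l}" by auto
  show ?thesis
    unfolding reduced_groebner_basis_def B
  proof (intro conjI ballI)
    show "(\<lambda>i. at_U l p * (t_var i - 1)) ` {1..l} \<subseteq> I" using gen by auto
    show "0 \<notin> (\<lambda>i. at_U l p * (t_var i - 1)) ` {1..l}" using nz by (metis (no_types, lifting) imageE)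
    show "\<exists>g \<in> (\<lambda>i. at_U l p * (t_var i - 1)) ` {1..l}. monom_dvd (lead_monom g) (lead_monom f)"
      if "f \<in> I - {0}" for f
      using div[of f] that by (auto simp: lm)
    show "lk g (lead_monom g) = 1" if "g \<in> (\<lambda>i. at_U l p * (t_var i - 1)) ` {1..l}" for g
      using that by (auto simp: lm monic)
    show "\<not> monom_dvd (lead_monom h) e"
      if gh: "g \<in> (\<lambda>i. at_U l p * (t_var i - 1)) ` {1..l}"
        "h \<in> (\<lambda>i. at_U l p * (t_var i - 1)) ` {1..l} - {g}" "e \<in> Poly_Mapping.keys g" for g h e
    proof -
      obtain i where i: "g = at_U l p * (t_var i - 1)" using gh(1) by auto
      obtain j where j: "h = at_U l p * (t_var j - 1)" "j \<in> {1..l}" using gh(2) by blast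
      have "i \<noteq> j" using gh(2) i j by auto
      then show ?thesis using red[of i j e] gh(3) i j by (simp add: lm)
    qed
  qed simp
qed

lemma reduced_groebner_basis_principal:
  assumes l: "1 \<le> l" and p: "lead_coeff p = 1" "poly.coeff p 0 \<noteq> 0"
    and I: "\<And>f. f \<in> I \<Longrightarrow> f \<in> polynomials l \<and> (\<exists>h. f = at_U l p * h)"
    and gen: "at_U l p \<in> I"
  shows "reduced_groebner_basis I {at_U l p}"
proof -
  have p0: "p \<noteq> 0" using p(1) by auto
  have lm1: "lead_monom 1 = 0" by (simp add: lead_monom_def)
  have lm: "lead_monom (at_U l p) = u_pow l (degree p)"
    using lead_monom_at_U_mult[OF l p0, of 1] by (simp add: lm1)
  have monic: "lk (at_U l p) (u_pow l (degree p)) = 1"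
    using lookup_lead_at_U_mult(1)[OF l, of p 1] p(1) by (simp add: lm1)
  have "monom_dvd (u_pow l (degree p)) (lead_monom f)" if f: "f \<in> I" "f \<noteq> 0" for f
  proof -
    obtain h where h: "f = at_U l p * h" and poly: "f \<in> polynomials l"
      using I[OF f(1)] by auto
    have h0: "h \<noteq> 0" using f(2) h by auto
    have "h \<in> polynomials l" using cofactor_polynomials[OF l p(2)] poly h by blast
    then have "0 \<le> lk (lead_monom h) i" for i
      using lead_monom_in_keys[OF h0] unfolding mem_polynomials by blast
    then show ?thesis
      unfolding h lead_monom_at_U_mult[OF l p0 h0] by (simp add: monom_dvd_def lookup_add)
  qed
  moreover have "at_U l p \<noteq> 0" using monic by auto
  ultimately show ?thesis
    unfolding reduced_groebner_basis_def using gen lm monic by auto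
qed

section \<open>The ring of Laurent polynomials\<close>

abbreviation laurent_set :: "nat \<Rightarrow> laurent set" where
  "laurent_set l \<equiv> carrier (laurent_ring l)"

lemma mem_laurent_set: "f \<in> laurent_set l \<longleftrightarrow> (\<forall>e \<in> Poly_Mapping.keys f. Poly_Mapping.keys e \<subseteq> {1..l})"
  by (auto simp: laurent_ring_def Z_lattice_def)

lemma laurent_set_subring: "unital_subring (laurent_set l)"
proof
  fix f g assume fg: "f \<in> laurent_set l" "g \<in> laurent_set l"
  show "f + g \<in> laurent_set l"
    using fg keys_add[of f g] unfolding mem_laurent_set by blast
  show "f * g \<in> laurent_set l"
    unfolding mem_laurent_set
  proof
    fix e assume "e \<in> Poly_Mapping.keys (f * g)"
    then obtain c d where "c \<in> Poly_Mapping.keys f" "d \<in> Poly_Mapping.keys g" "e = c + d"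
      using keys_mult[of f g] by blast
    then show "Poly_Mapping.keys e \<subseteq> {1..l}"
      using fg keys_add[of c d] unfolding mem_laurent_set by blast
  qed
qed (auto simp: mem_laurent_set in_keys_iff lookup_one when_def)

lemma t_monom_laurent_set: "Poly_Mapping.keys e \<subseteq> {1..l} \<Longrightarrow> t_monom e \<in> laurent_set l"
  by (simp add: mem_laurent_set t_monom_def)

lemma polynomials_laurent_set: "polynomials l \<subseteq> laurent_set l"
  by (auto simp: polynomials_def)

lemma one_polynomials: "1 \<in> polynomials l"
  by (auto simp: mem_polynomials in_keys_iff lookup_one when_def)

lemma at_U_polynomials: "at_U l p \<in> polynomials l"
  using at_U_mult_polynomials[OF one_polynomials, of l p] by simp

lemma at_U_laurent_set: "at_U l p \<in> laurent_set l"
  using at_U_polynomials polynomials_laurent_set by blast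

lemma polynomials_diff: "f \<in> polynomials l \<Longrightarrow> g \<in> polynomials l \<Longrightarrow> f - g \<in> polynomials l"
  using keys_diff[of f g] unfolding mem_polynomials by blast

lemma t_var_polynomials: "i \<in> {1..l} \<Longrightarrow> t_var i \<in> polynomials l"
  by (auto simp: mem_polynomials t_var_def t_monom_def lookup_basis_vec)

lemma laurent_ring_cring: "cring (laurent_ring l)"
proof -
  interpret unital_subring "laurent_set l" by (rule laurent_set_subring)
  have car: "laurent_set l = {f. Poly_Mapping.keys f \<subseteq> carrier (Z_lattice l)}"
    by (simp add: laurent_ring_def)
  have neg: "\<exists>y \<in> laurent_set l. y + x = 0" if "x \<in> laurent_set l" for x
    using uminus_mem[OF that] by (intro bexI[of _ "- x"]) auto
  show ?thesis
    using zero_mem one_mem add_mem mult_mem neg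
    by unfold_locales (auto simp: laurent_ring_def algebra_simps Units_def)
qed

lemma ideal_over_ideal:
  assumes "ideal I (laurent_ring l)"
  shows "ideal_over (laurent_set l) I"
proof -
  interpret ideal I "laurent_ring l" by fact
  show ?thesis
    using additive_subgroup.zero_closed[OF additive_subgroup_axioms]
      additive_subgroup.a_closed[OF additive_subgroup_axioms] I_l_closed
    by (auto simp: ideal_over_def laurent_ring_def)
qed

lemma ideal_ideal_over:
  assumes J: "ideal_over (laurent_set l) J"
  shows "ideal (J \<inter> laurent_set l) (laurent_ring l)"
proof -
  interpret R: unital_subring "laurent_set l" by (rule laurent_set_subring)
  interpret cring "laurent_ring l" by (rule laurent_ring_cring)
  have neg: "\<ominus>\<^bsub>laurent_ring l\<^esub> x = - x" if "x \<in> laurent_set l" for x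
    by (rule minus_equality) (use that R.uminus_mem in \<open>auto simp: laurent_ring_def\<close>)
  have ops: "x \<oplus>\<^bsub>laurent_ring l\<^esub> y = x + y" "x \<otimes>\<^bsub>laurent_ring l\<^esub> y = x * y" "\<zero>\<^bsub>laurent_ring l\<^esub> = 0" for x y
    by (simp_all add: laurent_ring_def)
  have right: "a * x \<in> J" if "a \<in> J" "x \<in> laurent_set l" for a x
    using ideal_overD(3)[OF J that(2,1)] by (simp add: mult.commute)
  show ?thesis
  proof (rule idealI[OF ring_axioms])
    show "subgroup (J \<inter> laurent_set l) (add_monoid (laurent_ring l))"
    proof (rule group.subgroupI[OF a_group])
      show "inv\<^bsub>add_monoid (laurent_ring l)\<^esub> x \<in> J \<inter> laurent_set l" if "x \<in> J \<inter> laurent_set l" for x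
      proof -
        have "- x \<in> J" using ideal_overD(3)[OF J R.uminus_mem[OF R.one_mem], of x] that by simp
        then show ?thesis using neg[of x] that R.uminus_mem by (simp add: a_inv_def)
      qed
    qed (use ideal_overD[OF J] R.add_mem R.zero_mem in \<open>auto simp: ops\<close>)
  qed (use ideal_overD[OF J] right R.mult_mem in \<open>auto simp: ops\<close>)
qed

lemma genideal_laurent_ring:
  assumes S: "S \<subseteq> laurent_set l"
  shows "ideal_over (laurent_set l) (Idl\<^bsub>laurent_ring l\<^esub> S)" "S \<subseteq> Idl\<^bsub>laurent_ring l\<^esub> S"
    and "ideal_over (laurent_set l) J \<Longrightarrow> S \<subseteq> J \<Longrightarrow> Idl\<^bsub>laurent_ring l\<^esub> S \<subseteq> J"
proof -
  interpret cring "laurent_ring l" by (rule laurent_ring_cring)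
  show "ideal_over (laurent_set l) (Idl\<^bsub>laurent_ring l\<^esub> S)"
    by (rule ideal_over_ideal[OF genideal_ideal[OF S]])
  show "S \<subseteq> Idl\<^bsub>laurent_ring l\<^esub> S" by (rule genideal_self[OF S])
  show "Idl\<^bsub>laurent_ring l\<^esub> S \<subseteq> J" if "ideal_over (laurent_set l) J" "S \<subseteq> J"
    using genideal_minimal[OF ideal_ideal_over[OF that(1)], of S] that(2) S by auto
qed

lemma group_character_laurent:
  assumes "group G" and \<phi>: "\<phi> \<in> hom G (Z_lattice l)"
  shows "group_character G (laurent_set l) (\<lambda>x. t_monom (\<phi> x))"
proof -
  interpret group G by fact
  interpret unital_subring "laurent_set l" by (rule laurent_set_subring)
  have mult: "\<phi> (x \<otimes>\<^bsub>G\<^esub> y) = \<phi> x + \<phi> y" if "x \<in> carrier G" "y \<in> carrier G" for x y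
    using hom_mult[OF \<phi> that] by (simp add: Z_lattice_def)
  have one: "\<phi> \<one>\<^bsub>G\<^esub> = 0" using mult[of "\<one>\<^bsub>G\<^esub>" "\<one>\<^bsub>G\<^esub>"] by simp
  have "Poly_Mapping.keys (\<phi> x) \<subseteq> {1..l}" if "x \<in> carrier G" for x
    using \<phi> that by (auto simp: hom_def Z_lattice_def)
  then show ?thesis
    by unfold_locales (simp_all add: one mult t_monom_add t_monom_laurent_set)
qed

text \<open>Whatever presentation the choice in \<open>elementary_ideal\<close> picks, the ideal is the one generated by
  the determinants of any other presentation. It is described here by its universal property.\<close>

lemma elementary_ideal_relation_module:
  fixes k :: nat
  assumes \<phi>: "\<phi> \<in> hom G (Z_lattice l)" and pres: "presents G M rs h"
  defines "S \<equiv> dets (laurent_set l) (M - k) M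
      (group_character.relation_module G (laurent_set l) (\<lambda>x. t_monom (\<phi> x)) M h)"
  shows "ideal_over (laurent_set l) (elementary_ideal l k G \<phi>)"
    and "S \<subseteq> elementary_ideal l k G \<phi>"
    and "ideal_over (laurent_set l) J \<Longrightarrow> S \<subseteq> J \<Longrightarrow> elementary_ideal l k G \<phi> \<subseteq> J"
proof -
  have "group G" using pres by (simp add: presents_def)
  then interpret group_character G "laurent_set l" "\<lambda>x. t_monom (\<phi> x)"
    using \<phi> by (rule group_character_laurent)
  obtain N rs' g where some: "(SOME (N, rs, g). presents G N rs g) = (N, rs', g)"
    by (metis prod_cases3)
  have pres': "presents G N rs' g"
    using someI[of "\<lambda>(N, rs, g). presents G N rs g" "(M, rs, h)"] pres some by simp
  let ?A = "mat (length rs') N (\<lambda>(i, j). deriv g (rs' ! i) j)"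
  have "fox_matrix G \<phi> N rs' g = ?A"
    by (simp add: fox_matrix_def induced_map_def deriv_def)
  then have E: "elementary_ideal l k G \<phi> = Idl\<^bsub>laurent_ring l\<^esub> (minors ?A (N - k))"
    by (simp add: elementary_ideal_def some)
  have indep: "minors ?A (N - k) \<subseteq> J \<longleftrightarrow> S \<subseteq> J" if "ideal_over (laurent_set l) J" for J
    unfolding S_def by (rule elementary_minors_independent[OF that pres' pres])
  have g: "g ` {..<N} \<subseteq> carrier G" "set rs' \<subseteq> words N" using pres' by (auto simp: presents_def)
  have minors: "minors ?A (N - k) \<subseteq> laurent_set l"
    by (rule minors_mem[of _ "length rs'" N])
      (use deriv_mem[OF g(1)] g(2) nth_mem in \<open>auto simp: subset_iff\<close>)
  note gen = genideal_laurent_ring[OF minors]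
  show "ideal_over (laurent_set l) (elementary_ideal l k G \<phi>)" unfolding E by (rule gen(1))
  show "S \<subseteq> elementary_ideal l k G \<phi>" using indep[OF gen(1)] gen(2) unfolding E by simp
  show "elementary_ideal l k G \<phi> \<subseteq> J" if "ideal_over (laurent_set l) J" "S \<subseteq> J"
    using gen(3)[OF that(1)] indep[OF that(1)] that(2) unfolding E by simp
qed

section \<open>The Fox matrix of a torus link\<close>

context group_character
begin

lemma character_replicate:
  assumes g: "g ` {..<N} \<subseteq> carrier G" "i < N"
  shows "\<tau> (word_value G g (replicate k (i, True))) = \<tau> (g i) ^ k"
proof (induction k)
  case (Suc k)
  have "g i \<in> carrier G" "replicate k (i, True) \<in> words N"
    using g by (auto simp: words_def)
  then show ?case using Suc g by (simp add: letter_value_def character_mult)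
qed simp

lemma deriv_replicate:
  assumes g: "g ` {..<N} \<subseteq> carrier G" "i < N"
  shows "deriv g (replicate k (i, True)) j = (if j = i then \<Sum>s<k. \<tau> (g i) ^ s else 0)"
proof (induction k)
  case (Suc k)
  have "(i, True) # replicate k (i, True) \<in> words N" using g by (auto simp: words_def)
  then show ?case
    using Suc by (simp add: deriv_Cons[OF g(1)] letter_value_def sum.lessThan_Suc_shift sum_distrib_left del: sum.lessThan_Suc)
qed simp

text \<open>The first relator gives \<open>\<tau>(\<alpha>)\<^sup>n = \<tau>(\<beta>)\<^sup>m\<close>. This cancels all factors in front of the derivatives
  of \<open>\<beta>\<^sup>-\<^sup>m\<close> and of \<open>f\<^sub>i\<^sup>-\<^sup>1\<close> except \<open>\<tau>(f\<^sub>i)\<close>.\<close>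

lemma torus_relator_derivs:
  assumes pres: "presents G (l + 1) (torus_relators l n m) g" and l: "1 \<le> l" and i: "i < l"
  defines "A \<equiv> \<Sum>s<n. \<tau> (g 0) ^ s" and "B \<equiv> \<Sum>s<m. \<tau> (g 1) ^ s"
  shows "deriv g (torus_relators l n m ! i) j =
    (if j = 0 then A else if j = 1 then - (if i = 0 then 1 else \<tau> (g (i + 1))) * B
     else if i \<noteq> 0 \<and> j = i + 1 then \<tau> (g 0) ^ n - 1 else 0)"
proof -
  let ?a = "replicate n (0 :: nat, True)" and ?b = "replicate m (1 :: nat, False)" and ?b' = "replicate m (1 :: nat, True)"
  have g: "g ` {..<l + 1} \<subseteq> carrier G" and rels: "set (torus_relators l n m) \<subseteq> words (l + 1)"
    and nc: "\<And>w. w \<in> words (l + 1) \<Longrightarrow> word_value G g w = \<one> \<longleftrightarrow> w \<in> normal_closure (l + 1) (set (torus_relators l n m))"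
    using pres by (auto simp: presents_def)
  have ab: "?a \<in> words (l + 1)" "?b' \<in> words (l + 1)" "?b \<in> words (l + 1)" using l by (auto simp: words_def)
  have b: "?b = word_inv ?b'" by (simp add: word_inv_def letter_inv_def map_replicate_const)
  have r0: "?a @ ?b \<in> set (torus_relators l n m)" by (simp add: torus_relators_def Let_def)
  then have "word_value G g (?a @ ?b) = \<one>" using nc rels normal_closure.relator by blast
  then have "word_value G g ?a \<otimes> word_value G g ?b = \<one>" using word_value_append[OF g ab(1,3)] by simp
  then have unit: "\<tau> (word_value G g ?a) * \<tau> (word_value G g ?b) = 1"
    using character_mult[of "word_value G g ?a" "word_value G g ?b"] g ab by simp
  have a: "\<tau> (word_value G g ?a) = \<tau> (g 0) ^ n" by (rule character_replicate[OF g]) simp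
  have da: "deriv g ?a j = (if j = 0 then A else 0)"
    unfolding A_def by (rule deriv_replicate[OF g]) simp
  have db: "deriv g ?b j = (if j = 1 then - \<tau> (word_value G g ?b) * B else 0)"
    using deriv_word_inv[OF g ab(2), of j] deriv_replicate[OF g, of 1 m j] l word_value_inv[OF g ab(2)]
    unfolding b by (simp add: B_def del: One_nat_def)
  have dab: "\<tau> (word_value G g ?a) * deriv g ?b j = (if j = 1 then - B else 0)"
    unfolding db using unit by (simp add: mult.assoc[symmetric] del: One_nat_def)
  show ?thesis
  proof (cases "i = 0")
    case True
    then have "deriv g (torus_relators l n m ! i) j = deriv g ?a j + \<tau> (word_value G g ?a) * deriv g ?b j"
      using deriv_append[OF g ab(1,3), of j] by (simp add: torus_relators_def Let_def)
    then show ?thesis unfolding dab da using True by simp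
  next
    case False
    let ?f = "[(i + 1, True)]" and ?f' = "[(i + 1, False)]"
    have "[1..<l] ! (i - 1) = i" "i - 1 < length [1..<l]" using False i by auto
    then have rel: "torus_relators l n m ! i = ?a @ ?f @ ?b @ ?f'"
      using False by (simp add: torus_relators_def Let_def nth_Cons')
    have f: "?f \<in> words (l + 1)" "?f' \<in> words (l + 1)" using i by auto
    have gi: "g (i + 1) \<in> carrier G" using g i by auto
    have vf: "word_value G g ?f = g (i + 1)" "word_value G g ?f' = inv g (i + 1)"
      using gi by (simp_all add: letter_value_def)
    have df: "deriv g ?f j = (if j = i + 1 then 1 else 0)"
      "deriv g ?f' j = (if j = i + 1 then - \<tau> (inv g (i + 1)) else 0)"
      using i by (auto simp: deriv_Cons[OF g])
    have "deriv g (?a @ ?f @ ?b @ ?f') j = deriv g ?a j + \<tau> (word_value G g ?a) * (deriv g ?f j +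
        \<tau> (g (i + 1)) * (deriv g ?b j + \<tau> (word_value G g ?b) * deriv g ?f' j))"
      using ab f vf(1) by (simp only: deriv_append[OF g] words_simps)
    also have "\<dots> = deriv g ?a j + \<tau> (word_value G g ?a) * deriv g ?f j +
        \<tau> (g (i + 1)) * (\<tau> (word_value G g ?a) * deriv g ?b j) +
        (\<tau> (word_value G g ?a) * \<tau> (word_value G g ?b)) * (\<tau> (g (i + 1)) * deriv g ?f' j)"
      by (simp add: algebra_simps)
    also have "\<dots> = deriv g ?a j + \<tau> (g 0) ^ n * deriv g ?f j +
        \<tau> (g (i + 1)) * (if j = 1 then - B else 0) + \<tau> (g (i + 1)) * deriv g ?f' j"
      unfolding dab unit by (simp only: a mult_1_left)
    finally show ?thesis
      unfolding rel da df using False character_inv(2)[OF gi] by auto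
  qed
qed

end

definition torus_row :: "nat \<Rightarrow> nat \<Rightarrow> nat \<Rightarrow> nat \<Rightarrow> nat \<Rightarrow> laurent" where
  "torus_row l m n i s = (if s = 0 then at_U l (A_poly m n)
     else if s = 1 then - (t_monom (prefix_vec i) * at_U l (B_poly m n))
     else if i \<noteq> 0 \<and> s = i + 1 then at_U l (U_poly (m * n)) else 0)"

lemma at_U_geometric: "at_U l (geometric d k) = (\<Sum>s<k. (t_monom (prefix_vec l) ^ d) ^ s)"
  by (simp add: geometric_def at_U_sum at_U_monom power_mult)

lemma torus_relation_module:
  assumes "torus_link_presentation l n m G \<phi>" and \<phi>: "\<phi> \<in> hom G (Z_lattice l)"
    and l: "1 \<le> l" and mn: "0 < m" "0 < n"
  obtains g where "presents G (l + 1) (torus_relators l n m) g"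
    "group_character.relation_module G (laurent_set l) (\<lambda>x. t_monom (\<phi> x)) (l + 1) g =
      lspan (laurent_set l) (l + 1) (torus_row l m n ` {..<l})"
proof -
  obtain g where pres: "presents G (l + 1) (torus_relators l n m) g"
    and \<phi>0: "\<phi> (g 0) = (\<Sum>i = 1..l. Poly_Mapping.single i (int m))"
    and \<phi>1: "\<phi> (g 1) = (\<Sum>i = 1..l. Poly_Mapping.single i (int n))"
    and \<phi>f: "\<And>i. i \<in> {1..<l} \<Longrightarrow> \<phi> (g (i + 1)) = (\<Sum>j = 1..i. basis_vec j)"
    using assms(1) unfolding torus_link_presentation_def by blast
  have "group G" using pres by (simp add: presents_def)
  then interpret group_character G "laurent_set l" "\<lambda>x. t_monom (\<phi> x)"
    using \<phi> by (rule group_character_laurent)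
  have mult: "(\<Sum>i = 1..l. Poly_Mapping.single i (int k)) = u_pow l k" for k
    by (simp add: prefix_vec_def frag_cmul_sum basis_vec_def)
      (rule sum.cong, auto intro!: poly_mapping_eqI simp: lookup_single when_def)
  have g0: "t_monom (\<phi> (g 0)) = t_monom (prefix_vec l) ^ m" and g1: "t_monom (\<phi> (g 1)) = t_monom (prefix_vec l) ^ n"
    by (simp_all only: \<phi>0 \<phi>1 mult t_monom_power)
  have len: "length (torus_relators l n m) = l" using l by (simp add: torus_relators_def Let_def)
  have row: "deriv g (torus_relators l n m ! i) j = torus_row l m n i j" if "i < l" for i j
  proof -
    have v: "t_monom (prefix_vec i) = (if i = 0 then 1 else t_monom (\<phi> (g (i + 1))))"
      using that \<phi>f[of i] by (auto simp: prefix_vec_def)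
    have D: "at_U l (U_poly (m * n)) = t_monom (\<phi> (g 0)) ^ n - 1"
      by (simp add: U_poly_def at_U_diff at_U_monom g0 power_mult)
    have A: "at_U l (A_poly m n) = (\<Sum>s<n. t_monom (\<phi> (g 0)) ^ s)"
      by (simp add: A_poly_eq mn at_U_geometric g0)
    have B: "at_U l (B_poly m n) = (\<Sum>s<m. t_monom (\<phi> (g 1)) ^ s)"
      by (simp add: B_poly_eq mn at_U_geometric g1[unfolded One_nat_def])
    show ?thesis
      unfolding torus_relator_derivs[OF pres l that] torus_row_def v D A B by simp
  qed
  have "relation_module (l + 1) g =
      lspan (laurent_set l) (l + 1) (torus_row l m n ` {..<l})"
    unfolding relation_module_presents[OF pres] len
  proof (intro subset_antisym subsetI)
    let ?A = "mat l (l + 1) (\<lambda>(i, j). deriv g (torus_relators l n m ! i) j)"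
    have eq: "?A $$ (i, s) = torus_row l m n i s" if "i < l" "s < l + 1" for i s
      using that row by simp
    fix y
    {
      assume "y \<in> lspan (laurent_set l) (l + 1) ((\<lambda>i s. ?A $$ (i, s)) ` {..<l})"
      then show "y \<in> lspan (laurent_set l) (l + 1) (torus_row l m n ` {..<l})"
      proof (rule lspan_lspan, intro subsetI)
        fix x assume "x \<in> (\<lambda>i s. ?A $$ (i, s)) ` {..<l}"
        then obtain i where i: "i < l" "x = (\<lambda>s. ?A $$ (i, s))" by auto
        show "x \<in> lspan (laurent_set l) (l + 1) (torus_row l m n ` {..<l})"
          by (rule lspan_base[of "torus_row l m n i"]) (use i eq in auto)
      qed
    next
      assume "y \<in> lspan (laurent_set l) (l + 1) (torus_row l m n ` {..<l})"
      then show "y \<in> lspan (laurent_set l) (l + 1) ((\<lambda>i s. ?A $$ (i, s)) ` {..<l})"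
      proof (rule lspan_lspan, intro subsetI)
        fix x assume "x \<in> torus_row l m n ` {..<l}"
        then obtain i where i: "i < l" "x = torus_row l m n i" by auto
        show "x \<in> lspan (laurent_set l) (l + 1) ((\<lambda>i s. ?A $$ (i, s)) ` {..<l})"
          by (rule lspan_base[OF imageI[of i]]) (use i eq in auto)
      qed
    }
  qed
  then show ?thesis using pres that by blast
qed

section \<open>Minors of the Fox matrix\<close>

lemma det_scale_columns:
  fixes y :: "nat \<Rightarrow> nat \<Rightarrow> 'a::comm_ring_1"
  shows "Determinant.det (mat d d (\<lambda>(i, j). w j * y i j)) = (\<Prod>j<d. w j) * Determinant.det (mat d d (\<lambda>(i, j). y i j))"
proof -
  have "(\<Prod>i = 0..<d. mat d d (\<lambda>(i, j). w j * y i j) $$ (i, p i)) =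
      (\<Prod>j<d. w j) * (\<Prod>i = 0..<d. mat d d (\<lambda>(i, j). y i j) $$ (i, p i))" if p: "p permutes {0..<d}" for p
  proof -
    have "p i < d" if "i < d" for i using permutes_in_image[OF p, of i] that by auto
    then have "(\<Prod>i = 0..<d. mat d d (\<lambda>(i, j). w j * y i j) $$ (i, p i)) = (\<Prod>i = 0..<d. w (p i)) * (\<Prod>i = 0..<d. y i (p i))"
      by (simp add: prod.distrib)
    also have "(\<Prod>i = 0..<d. w (p i)) = (\<Prod>i = 0..<d. w i)"
      using prod.permute[OF p, of w] by (simp add: comp_def)
    finally show ?thesis using \<open>\<And>i. i < d \<Longrightarrow> p i < d\<close> by (simp add: atLeast0LessThan)
  qed
  then show ?thesis
    by (simp add: det_def'[of _ d] sum_distrib_left algebra_simps)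
qed

lemma det_upper_triangular_fun:
  fixes f :: "nat \<Rightarrow> nat \<Rightarrow> 'a::comm_ring_1"
  assumes "\<And>i j. i < d \<Longrightarrow> j < i \<Longrightarrow> f i j = 0"
  shows "Determinant.det (mat d d (\<lambda>(i, j). f i j)) = (\<Prod>i<d. f i i)"
proof -
  let ?M = "mat d d (\<lambda>(i, j). f i j)"
  have "Determinant.det ?M = prod_list (diag_mat ?M)"
    by (rule det_upper_triangular[of _ d]) (auto simp: assms)
  also have "\<dots> = (\<Prod>i<d. f i i)"
    by (simp add: diag_mat_def prod.list_conv_set_nth atLeast0LessThan)
  finally show ?thesis .
qed

locale torus_parameters =
  fixes l m n :: nat
  assumes l: "1 \<le> l" and m: "0 < m" and n: "0 < n" and mn: "coprime m n"
begin

sublocale unital_subring "laurent_set l"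
  by (rule laurent_set_subring)

abbreviation Apol where "Apol \<equiv> at_U l (A_poly m n)"
abbreviation Bpol where "Bpol \<equiv> at_U l (B_poly m n)"
abbreviation Dpol where "Dpol \<equiv> at_U l (U_poly (m * n))"
abbreviation row_module where "row_module \<equiv> lspan (laurent_set l) (l + 1) (torus_row l m n ` {..<l})"

lemma augmentation_at_U_poly [simp]: "augmentation (at_U l (U_poly k)) = 0"
proof -
  interpret comm_ring_hom augmentation by (rule augmentation_hom)
  show ?thesis by (simp add: U_poly_def at_U_diff at_U_monom hom_distribs)
qed

lemma Dpol_factor: "Dpol = Apol * at_U l (U_poly m)" "Dpol = Bpol * at_U l (U_poly n)"
  using U_poly_factor[OF m n] by (simp_all flip: at_U_mult)

lemma at_U_P_poly: "k < l \<Longrightarrow> at_U l (P_poly l m n k) = Dpol ^ (l - 1 - k) * (Apol * Bpol)"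
  by (simp add: P_poly_def at_U_mult at_U_power)

text \<open>The sign in the factor \<open>- B\<close> is chosen so that, after the factors are taken out, the
  augmentation maps the columns of \<open>\<alpha>\<close> and \<open>\<beta>\<close> to the same column.\<close>

definition column_factor :: "nat \<Rightarrow> laurent" where
  "column_factor s = (if s = 0 then Apol else if s = 1 then - Bpol else Dpol)"

definition reduced_row :: "nat \<Rightarrow> nat \<Rightarrow> laurent" where
  "reduced_row i s = (if s = 0 then 1 else if s = 1 then t_monom (prefix_vec i)
     else if i \<noteq> 0 \<and> s = i + 1 then 1 else 0)"

lemma torus_row_factor: "torus_row l m n i s = column_factor s * reduced_row i s"
  by (simp add: torus_row_def column_factor_def reduced_row_def)

lemma augmentation_det_reduced:
  assumes "a < d" "b < d" "c a = 0" "c b = 1"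
  shows "augmentation (Determinant.det (mat d d (\<lambda>(i, j). reduced_row (\<rho> i) (c j)))) = 0"
proof -
  interpret comm_ring_hom augmentation by (rule augmentation_hom)
  let ?Y = "mat d d (\<lambda>(i, j). reduced_row (\<rho> i) (c j))"
  have "augmentation (Determinant.det ?Y) = Determinant.det (map_mat augmentation ?Y)"
    by simp
  also have "\<dots> = 0"
    by (rule det_identical_columns[of _ d a b])
      (use assms in \<open>auto intro!: eq_vecI simp: reduced_row_def\<close>)
  finally show ?thesis .
qed

text \<open>\<open>C\<close> is the set of columns of a minor. If the column of \<open>\<alpha>\<close> or that of \<open>\<beta>\<close> is missing, a factor
  \<open>D\<close> takes its place, and it contains the missing \<open>A\<close> or \<open>B\<close> with a cofactor \<open>U\<^sup>m - 1\<close> or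
  \<open>U\<^sup>n - 1\<close> of augmentation 0.\<close>

lemma column_factor_prod:
  assumes "finite C" "2 \<le> card C"
  shows "\<exists>h. prod column_factor C = Dpol ^ (card C - 2) * (Apol * Bpol) * h \<and> (0 \<in> C \<and> 1 \<in> C \<or> augmentation h = 0)"
proof -
  define C' where "C' = C - {0, 1}"
  have C': "finite C'" "0 \<notin> C'" "1 \<notin> C'" "prod column_factor C' = Dpol ^ card C'"
    using assms by (auto simp: C'_def column_factor_def)
  have aug: "augmentation (- (x :: laurent)) = - augmentation x" for x
    using comm_ring_hom.axioms augmentation_hom by (metis add.inverse_unique augmentation_0 augmentation_add add.right_inverse)
  consider "0 \<in> C" "1 \<in> C" | "0 \<in> C" "1 \<notin> C" | "0 \<notin> C" "1 \<in> C" | "0 \<notin> C" "1 \<notin> C" by blast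
  then show ?thesis
  proof cases
    case 1
    then have C: "C = insert 0 (insert 1 C')" by (auto simp: C'_def)
    then have "card C = card C' + 2" using C' by simp
    then have "prod column_factor C = Dpol ^ (card C - 2) * (Apol * Bpol) * (- 1)"
      unfolding C using C' by (simp add: column_factor_def)
    then show ?thesis using 1 by blast
  next
    case 2
    then have C: "C = insert 0 C'" by (auto simp: C'_def)
    then have "card C' = Suc (card C - 2)" using C' assms by simp
    then have "prod column_factor C = Dpol ^ (card C - 2) * (Dpol * Apol)"
      using C' by (subst C) (simp add: column_factor_def)
    also have "\<dots> = Dpol ^ (card C - 2) * (Apol * Bpol) * at_U l (U_poly n)"
      by (subst (2) Dpol_factor(2)) (simp add: algebra_simps)
    finally show ?thesis by (metis augmentation_at_U_poly)
  next
    case 3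
    then have C: "C = insert 1 C'" by (auto simp: C'_def)
    then have "card C' = Suc (card C - 2)" using C' assms by simp
    then have "prod column_factor C = Dpol ^ (card C - 2) * (Dpol * - Bpol)"
      using C' by (subst C) (simp add: column_factor_def)
    also have "\<dots> = Dpol ^ (card C - 2) * (Apol * Bpol) * (- at_U l (U_poly m))"
      by (subst (2) Dpol_factor(1)) (simp add: algebra_simps)
    finally show ?thesis by (metis augmentation_at_U_poly aug neg_0_equal_iff_equal)
  next
    case 4
    then have C: "C = C'" by (auto simp: C'_def)
    then have "card C' = Suc (Suc (card C - 2))" using assms by simp
    then have "prod column_factor C = Dpol ^ (card C - 2) * (Dpol * Dpol)"
      using C' by (subst C) simp
    also have "\<dots> = Dpol ^ (card C - 2) * (Apol * Bpol) * (at_U l (U_poly m) * at_U l (U_poly n))"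
      by (subst (2) Dpol_factor(1), subst (2) Dpol_factor(2)) (simp add: algebra_simps)
    finally show ?thesis by (metis augmentation_at_U_poly augmentation_mult mult_zero_left)
  qed
qed

lemma ideal_over_augmentation_multiples:
  "ideal_over (laurent_set l) {p * h | h. augmentation h = 0}"
proof -
  have "\<exists>h. (0::laurent) = p * h \<and> augmentation h = 0" by (rule exI[of _ 0]) simp
  moreover have "\<exists>h. p * x + p * y = p * h \<and> augmentation h = 0"
    if "augmentation x = 0" "augmentation y = 0" for x y
    by (rule exI[of _ "x + y"]) (simp add: algebra_simps augmentation_add that)
  moreover have "\<exists>h. c * (p * x) = p * h \<and> augmentation h = 0" if "augmentation x = 0" for c x
    by (rule exI[of _ "c * x"]) (simp add: algebra_simps augmentation_mult that)
  ultimately show ?thesis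
    unfolding ideal_over_def by (clarsimp, blast)
qed

lemma ideal_over_multiples: "ideal_over (laurent_set l) {h. p dvd h}"
  by (simp add: ideal_over_def)

text \<open>At least \<open>l - 1 - k\<close> columns of a minor of size \<open>l + 1 - k\<close> belong to the \<open>f\<^sub>i\<close>.\<close>

lemma torus_dets_upper:
  assumes k: "1 \<le> k" "k < l"
  shows "dets (laurent_set l) (l + 1 - k) (l + 1) row_module \<subseteq> {at_U l (P_poly l m n k) * h | h. augmentation h = 0}"
proof (rule dets_lspan_subset[OF ideal_over_augmentation_multiples])
  let ?d = "l + 1 - k"
  fix r :: "nat \<Rightarrow> nat \<Rightarrow> laurent" and c :: "nat \<Rightarrow> nat"
  assume r: "\<And>i. i < ?d \<Longrightarrow> r i \<in> torus_row l m n ` {..<l}" and c: "inj_on c {..<?d}"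
  from r have "\<forall>i. \<exists>a. i < ?d \<longrightarrow> r i = torus_row l m n a" by blast
  from choice[OF this] obtain \<rho> where \<rho>: "\<And>i. i < ?d \<Longrightarrow> r i = torus_row l m n (\<rho> i)" by blast
  let ?Y = "mat ?d ?d (\<lambda>(i, j). reduced_row (\<rho> i) (c j))"
  have "Determinant.det (mat ?d ?d (\<lambda>(i, j). r i (c j))) =
      Determinant.det (mat ?d ?d (\<lambda>(i, j). column_factor (c j) * reduced_row (\<rho> i) (c j)))"
    by (rule det_mat_cong) (simp add: \<rho> torus_row_factor)
  also have "\<dots> = (\<Prod>j<?d. column_factor (c j)) * Determinant.det ?Y"
    by (rule det_scale_columns)
  also have "(\<Prod>j<?d. column_factor (c j)) = prod column_factor (c ` {..<?d})"
    using prod.reindex[OF c, of column_factor] by (simp add: comp_def)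
  finally have det: "Determinant.det (mat ?d ?d (\<lambda>(i, j). r i (c j))) = prod column_factor (c ` {..<?d}) * Determinant.det ?Y" .
  have card: "card (c ` {..<?d}) = ?d" using c by (simp add: card_image)
  have deg: "?d - 2 = l - 1 - k" using k by simp
  have two: "2 \<le> ?d" "finite (c ` {..<?d})" using k by auto
  obtain h where h: "prod column_factor (c ` {..<?d}) = Dpol ^ (?d - 2) * (Apol * Bpol) * h"
    "0 \<in> c ` {..<?d} \<and> 1 \<in> c ` {..<?d} \<or> augmentation h = 0"
    using column_factor_prod[of "c ` {..<?d}", unfolded card] k two by blast
  have "augmentation (h * Determinant.det ?Y) = 0"
    using h(2)
  proof
    assume "0 \<in> c ` {..<?d} \<and> 1 \<in> c ` {..<?d}"
    then obtain a b where "a < ?d" "b < ?d" "c a = 0" "c b = 1" by (auto simp del: One_nat_def)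
    then show ?thesis using augmentation_det_reduced[of a ?d b c \<rho>] by (simp add: augmentation_mult)
  qed (simp add: augmentation_mult)
  moreover have "Determinant.det (mat ?d ?d (\<lambda>(i, j). r i (c j))) = at_U l (P_poly l m n k) * (h * Determinant.det ?Y)"
    unfolding det h(1) at_U_P_poly[OF k(2)] deg by (simp only: mult.assoc)
  ultimately show "Determinant.det (mat ?d ?d (\<lambda>(i, j). r i (c j))) \<in> {at_U l (P_poly l m n k) * h | h. augmentation h = 0}"
    by blast
qed

lemma torus_dets_principal_upper:
  "dets (laurent_set l) 1 (l + 1) row_module \<subseteq> {h. at_U l (P_poly l m n l) dvd h}"
proof (rule dets_lspan_subset[OF ideal_over_multiples])
  fix r :: "nat \<Rightarrow> nat \<Rightarrow> laurent" and c :: "nat \<Rightarrow> nat"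
  assume r: "\<And>i. i < 1 \<Longrightarrow> r i \<in> torus_row l m n ` {..<l}"
  let ?g = "gcd (A_poly m n) (B_poly m n)"
  obtain i where i: "r 0 = torus_row l m n i" using r[of 0] by auto
  have "at_U l ?g dvd at_U l p" if "?g dvd p" for p
    using that by (auto simp: dvd_def at_U_mult)
  then have "at_U l ?g dvd Apol" "at_U l ?g dvd Bpol" by auto
  moreover from this(1) have "at_U l ?g dvd Dpol" by (simp add: Dpol_factor(1))
  ultimately have "at_U l ?g dvd column_factor (c 0)" by (simp add: column_factor_def)
  then have "at_U l ?g dvd r 0 (c 0)" by (simp add: i torus_row_factor)
  then show "Determinant.det (mat 1 1 (\<lambda>(i, j). r i (c j))) \<in> {h. at_U l (P_poly l m n l) dvd h}"
    by (subst det_single) (auto simp: P_poly_def)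
qed

lemma torus_row_mem: "i < l \<Longrightarrow> torus_row l m n i \<in> row_module"
  by (rule lspan_base[of "torus_row l m n i"]) auto

text \<open>Subtracting row 0 clears the column of \<open>\<alpha>\<close>, so that suitable minors become triangular.\<close>

definition reduced_difference :: "nat \<Rightarrow> nat \<Rightarrow> laurent" where
  "reduced_difference i s = torus_row l m n i s - torus_row l m n 0 s"

lemma reduced_difference_mem: "i < l \<Longrightarrow> reduced_difference i \<in> row_module"
  by (rule lspan.step[OF torus_row_mem[of i], of "- 1" "torus_row l m n 0"])
    (use l uminus_mem[OF one_mem] in \<open>auto simp: reduced_difference_def\<close>)

lemma reduced_difference_simps:
  "reduced_difference i 0 = 0" "reduced_difference i (Suc 0) = (1 - t_monom (prefix_vec i)) * Bpol"
  "s \<ge> 2 \<Longrightarrow> i \<noteq> 0 \<Longrightarrow> reduced_difference i s = (if s = i + 1 then Dpol else 0)"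
  by (auto simp: reduced_difference_def torus_row_def prefix_vec_def algebra_simps)

lemma obtain_indices:
  assumes "finite S" "q \<le> card (S :: nat set)"
  obtains e :: "nat \<Rightarrow> nat" where "inj_on e {..<q}" "\<And>p. p < q \<Longrightarrow> e p \<in> S"
proof -
  obtain h where h: "bij_betw h {0..<card S} S" using ex_bij_betw_nat_finite[OF assms(1)] by blast
  show ?thesis
    by (rule that[of h]) (use h assms(2) in \<open>auto simp: bij_betw_def intro: inj_on_subset\<close>)
qed

text \<open>The rows are \<open>q\<close> differences followed by row 0, the columns those of the corresponding \<open>f\<^sub>i\<close>
  followed by that of \<open>\<alpha>\<close> or \<open>\<beta>\<close>.\<close>

lemma minor_with_one_special_column:
  assumes q: "q \<le> l - 1" and c0: "c0 \<in> {0, 1}"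
  shows "Dpol ^ q * torus_row l m n 0 c0 \<in> dets (laurent_set l) (q + 1) (l + 1) row_module"
proof -
  obtain e where e: "inj_on e {..<q}" "\<And>p. p < q \<Longrightarrow> e p \<in> {1..<l}"
    using obtain_indices[of "{1..<l}" q] q by auto
  define r where "r p = (if p < q then reduced_difference (e p) else torus_row l m n 0)" for p
  define c where "c p = (if p < q then e p + 1 else c0)" for p
  have "Determinant.det (mat (q + 1) (q + 1) (\<lambda>(i, j). r i (c j))) = (\<Prod>i<q + 1. r i (c i))"
  proof (rule det_upper_triangular_fun)
    fix i j assume ij: "i < q + 1" "j < i"
    then have "e j \<in> {1..<l}" using e(2) by auto
    moreover have "i < q \<Longrightarrow> e i \<noteq> e j" using ij inj_onD[OF e(1), of i j] by auto
    ultimately show "r i (c j) = 0"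
      using ij e(2)[of i] by (auto simp: r_def c_def reduced_difference_simps torus_row_def)
  qed
  also have "\<dots> = (\<Prod>i<q. Dpol) * torus_row l m n 0 c0"
  proof -
    have "(\<Prod>i<q. r i (c i)) = (\<Prod>i<q. Dpol)"
    proof (rule prod.cong)
      fix i assume "i \<in> {..<q}"
      then show "r i (c i) = Dpol" using e(2)[of i] by (auto simp: r_def c_def reduced_difference_simps)
    qed simp
    then show ?thesis by (simp add: r_def c_def)
  qed
  finally have "Dpol ^ q * torus_row l m n 0 c0 = Determinant.det (mat (q + 1) (q + 1) (\<lambda>(i, j). r i (c j)))" by simp
  also have "\<dots> \<in> dets (laurent_set l) (q + 1) (l + 1) row_module"
  proof (rule coordinate_det_mem_dets)
    show "r i \<in> row_module" for i
      using e(2)[of i] l reduced_difference_mem[of "e i"] torus_row_mem[of 0] by (auto simp: r_def)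
    show "c j < l + 1" for j using e(2)[of j] c0 l by (auto simp: c_def)
  qed
  finally show ?thesis .
qed

text \<open>The difference for \<open>i0\<close> is put last, below row 0, and the columns of \<open>\<alpha>\<close> and \<open>\<beta>\<close> come last in
  this order; as the column of \<open>f\<^sub>i\<^sub>0\<close> is not used, the matrix is triangular.\<close>

lemma minor_with_both_special_columns:
  assumes i: "1 \<le> i0" "i0 < l" and q: "q \<le> l - 2"
  shows "Dpol ^ q * (Apol * ((1 - t_monom (prefix_vec i0)) * Bpol)) \<in> dets (laurent_set l) (q + 2) (l + 1) row_module"
proof -
  have "q \<le> card ({1..<l} - {i0})" using q i by (subst card_Diff_singleton) auto
  then obtain e where e: "inj_on e {..<q}" "\<And>p. p < q \<Longrightarrow> e p \<in> {1..<l} - {i0}"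
    using obtain_indices[of "{1..<l} - {i0}" q] by auto
  define r where "r p = (if p < q then reduced_difference (e p) else if p = q then torus_row l m n 0
    else reduced_difference i0)" for p
  define c where "c p = (if p < q then e p + 1 else if p = q then 0 else 1)" for p
  have "Determinant.det (mat (q + 2) (q + 2) (\<lambda>(i, j). r i (c j))) = (\<Prod>i<q + 2. r i (c i))"
  proof (rule det_upper_triangular_fun)
    fix i j assume ij: "i < q + 2" "j < i"
    have ej: "j < q \<Longrightarrow> e j \<in> {1..<l} - {i0}" using e(2) by auto
    have "i < q \<Longrightarrow> e i \<noteq> e j" using ij inj_onD[OF e(1), of i j] by auto
    then show "r i (c j) = 0"
      using ij i e(2)[of i] ej by (cases "j < q") (auto simp: r_def c_def reduced_difference_simps torus_row_def)
  qed
  also have "\<dots> = (\<Prod>i<q. Dpol) * (Apol * ((1 - t_monom (prefix_vec i0)) * Bpol))"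
  proof -
    have "(\<Prod>i<q. r i (c i)) = (\<Prod>i<q. Dpol)"
    proof (rule prod.cong)
      fix i assume "i \<in> {..<q}"
      then show "r i (c i) = Dpol" using e(2)[of i] by (auto simp: r_def c_def reduced_difference_simps)
    qed simp
    then show ?thesis by (simp add: r_def c_def reduced_difference_simps torus_row_def mult.assoc)
  qed
  finally have "Dpol ^ q * (Apol * ((1 - t_monom (prefix_vec i0)) * Bpol)) =
    Determinant.det (mat (q + 2) (q + 2) (\<lambda>(i, j). r i (c j)))" by simp
  also have "\<dots> \<in> dets (laurent_set l) (q + 2) (l + 1) row_module"
  proof (rule coordinate_det_mem_dets)
    show "r p \<in> row_module" for p
      using e(2)[of p] l i reduced_difference_mem[of "e p"] reduced_difference_mem[of i0] torus_row_mem[of 0]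
      by (auto simp: r_def)
    show "c p < l + 1" for p using e(2)[of p] l by (auto simp: c_def)
  qed
  finally show ?thesis .
qed

lemma prefix_vec_Suc: "prefix_vec (Suc i) = prefix_vec i + basis_vec (Suc i)"
  by (simp add: prefix_vec_def)

lemma keys_prefix_vec: "i \<le> l \<Longrightarrow> Poly_Mapping.keys (prefix_vec i) \<subseteq> {1..l}"
  by (auto simp: prefix_vec_def in_keys_iff lookup_sum lookup_basis_vec split: if_splits)

text \<open>The triangular minors give \<open>P\<^sub>k(U)\<close> times \<open>T\<^sub>i - 1\<close> for \<open>1 \<le> i < l\<close> and times \<open>U\<^sup>m - 1\<close> and
  \<open>U\<^sup>n - 1\<close>. The last two yield the case \<open>T\<^sub>l = U\<close>, and consecutive differences yield \<open>t\<^sub>i - 1\<close>.\<close>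

lemma torus_dets_lower:
  assumes k: "1 \<le> k" "k < l" and J: "ideal_over (laurent_set l) J"
    and sub: "dets (laurent_set l) (l + 1 - k) (l + 1) row_module \<subseteq> J"
    and i: "i \<in> {1..l}"
  shows "at_U l (P_poly l m n k) * (t_var i - 1) \<in> J"
proof -
  let ?P = "at_U l (P_poly l m n k)" and ?q = "l - 1 - k"
  let ?a = "at_U l (U_poly m)" and ?b = "at_U l (U_poly n)"
  have neg: "- x \<in> J" if "x \<in> J" for x
    using ideal_overD(3)[OF J uminus_mem[OF one_mem] that] by simp
  have d: "l + 1 - k = ?q + 2" "l + 1 - k = (?q + 1) + 1" using k by auto
  have P: "?P = Dpol ^ ?q * (Apol * Bpol)" using k by (simp add: at_U_P_poly)
  have T: "?P * (t_monom (prefix_vec j) - 1) \<in> J" if "1 \<le> j" "j < l" for j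
  proof -
    have "Dpol ^ ?q * (Apol * ((1 - t_monom (prefix_vec j)) * Bpol)) \<in> J"
      using minor_with_both_special_columns[OF that, of ?q] k sub unfolding d(1) by auto
    from neg[OF this] show ?thesis unfolding P by (simp add: algebra_simps)
  qed
  have "Dpol ^ (?q + 1) * torus_row l m n 0 0 \<in> J" "Dpol ^ (?q + 1) * torus_row l m n 0 1 \<in> J"
    using minor_with_one_special_column[of "?q + 1" 0] minor_with_one_special_column[of "?q + 1" 1] k sub unfolding d(2) by auto
  then have "Dpol ^ (?q + 1) * Apol \<in> J" "Dpol ^ (?q + 1) * Bpol \<in> J"
    using neg[of "- (Dpol ^ (?q + 1) * Bpol)"] by (simp_all add: torus_row_def prefix_vec_def)
  moreover have "Dpol ^ (?q + 1) * Apol = ?P * ?b"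
    unfolding P by (simp, subst (1) Dpol_factor(2), simp add: algebra_simps)
  moreover have "Dpol ^ (?q + 1) * Bpol = ?P * ?a"
    unfolding P by (simp, subst (1) Dpol_factor(1), simp add: algebra_simps)
  ultimately have ab: "?P * ?a \<in> J" "?P * ?b \<in> J" by simp_all
  obtain x y where "x * U_poly m + y * U_poly n = U_poly 1" using U_poly_bezout[OF m mn] .
  then have "at_U l (U_poly 1) = at_U l x * ?a + at_U l y * ?b"
    by (simp flip: at_U_mult at_U_add)
  then have "?P * at_U l (U_poly 1) = at_U l x * (?P * ?a) + at_U l y * (?P * ?b)"
    by (simp add: algebra_simps)
  also have "\<dots> \<in> J"
    by (intro ideal_overD(2,3)[OF J] at_U_laurent_set ab)
  also have "at_U l (U_poly 1) = t_monom (prefix_vec l) - 1"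
    using at_U_monom[of l 1] by (simp add: U_poly_def at_U_diff)
  finally have "?P * (t_monom (prefix_vec l) - 1) \<in> J" .
  moreover have "?P * (t_monom (prefix_vec 0) - 1) \<in> J" using ideal_overD(1)[OF J] by (simp add: prefix_vec_def)
  ultimately have T': "?P * (t_monom (prefix_vec j) - 1) \<in> J" if "j \<le> l" for j
    using T[of j] that by (cases "j = 0 \<or> j = l") auto
  obtain j where j: "i = Suc j" "j < l" using i by (cases i) auto
  have inv: "t_monom (- prefix_vec j) * t_monom (prefix_vec j) = 1"
    by (simp flip: t_monom_add)
  have eq: "t_var i - 1 = t_monom (- prefix_vec j) * ((t_monom (prefix_vec i) - 1) + - (t_monom (prefix_vec j) - 1))"
  proof -
    have "t_monom (- prefix_vec j) * ((t_monom (prefix_vec i) - 1) + - (t_monom (prefix_vec j) - 1)) =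
        (t_monom (- prefix_vec j) * t_monom (prefix_vec j)) * (t_var i - 1)"
      by (simp add: j prefix_vec_Suc t_monom_add t_var_def algebra_simps)
    then show ?thesis using inv by simp
  qed
  have "?P * (t_var i - 1) = t_monom (- prefix_vec j) * (?P * (t_monom (prefix_vec i) - 1) + - (?P * (t_monom (prefix_vec j) - 1)))"
    by (subst eq) (simp add: algebra_simps)
  also have "\<dots> \<in> J"
    by (intro ideal_overD(2,3)[OF J] t_monom_laurent_set neg T')
      (use j i keys_prefix_vec[of j] in auto)
  finally show ?thesis .
qed

lemma torus_dets_principal_lower:
  assumes J: "ideal_over (laurent_set l) J" and sub: "dets (laurent_set l) 1 (l + 1) row_module \<subseteq> J"
  shows "at_U l (P_poly l m n l) \<in> J"
proof -
  have "Apol \<in> J" "- Bpol \<in> J"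
    using minor_with_one_special_column[of 0 0] minor_with_one_special_column[of 0 1] sub by (auto simp: torus_row_def prefix_vec_def)
  obtain x y where "x * A_poly m n + y * B_poly m n = gcd (A_poly m n) (B_poly m n)"
    using bezout_coefficients_fst_snd by blast
  then have "at_U l (P_poly l m n l) = at_U l x * Apol + at_U l (- y) * (- Bpol)"
    by (simp add: P_poly_def at_U_uminus flip: at_U_mult at_U_add)
  also have "\<dots> \<in> J"
    by (intro ideal_overD(2,3)[OF J] at_U_laurent_set) fact+
  finally show ?thesis .
qed

end

section \<open>The reduced Groebner bases of torus links\<close>

lemma AG_torus:
  assumes l: "1 < l" and m: "0 < m" and n: "0 < n" and mn: "coprime m n"
    and \<phi>: "\<phi> \<in> hom G (Z_lattice l)" and pres: "torus_link_presentation l n m G \<phi>"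
  shows "1 \<le> k \<Longrightarrow> k < l \<Longrightarrow>
      AG l k G \<phi> = {at_U l (P_poly l m n k) * (t_var i - 1) | i. 1 \<le> i \<and> i \<le> l}"
    and "AG l l G \<phi> = {at_U l (P_poly l m n l)}"
proof -
  have l1: "1 \<le> l" using l by simp
  interpret torus_parameters l m n by unfold_locales (use l1 m n mn in auto)
  obtain g where g: "presents G (l + 1) (torus_relators l n m) g"
    "group_character.relation_module G (laurent_set l) (\<lambda>x. t_monom (\<phi> x)) (l + 1) g = row_module"
    using torus_relation_module[OF pres \<phi> l1 m n] .
  note E = elementary_ideal_relation_module[OF \<phi> g(1), unfolded g(2)]
  have diff: "f - h \<in> elementary_ideal l k G \<phi> \<inter> polynomials l"
    if "f \<in> elementary_ideal l k G \<phi> \<inter> polynomials l" "h \<in> elementary_ideal l k G \<phi> \<inter> polynomials l" for f h k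
  proof -
    have "f + (- 1) * h \<in> elementary_ideal l k G \<phi>"
      by (intro ideal_overD(2,3)[OF E(1)]) (use that uminus_mem in auto)
    then show ?thesis using that polynomials_diff by auto
  qed
  note unique = reduced_groebner_basis_unique[OF diff]
  note monic = P_poly_monic[OF m n]
  show "AG l k G \<phi> = {at_U l (P_poly l m n k) * (t_var i - 1) | i. 1 \<le> i \<and> i \<le> l}" if k: "1 \<le> k" "k < l"
    unfolding AG_def
  proof (rule unique, assumption, assumption, rule reduced_groebner_basis_augmentation[OF l1 monic])
    fix f assume "f \<in> elementary_ideal l k G \<phi> \<inter> polynomials l"
    then show "f \<in> polynomials l \<and> (\<exists>h. f = at_U l (P_poly l m n k) * h \<and> augmentation h = 0)"
      using E(3)[OF ideal_over_augmentation_multiples torus_dets_upper[OF k]] by blast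
  next
    fix i assume i: "i \<in> {1..l}"
    have "t_var i - 1 \<in> polynomials l"
      using polynomials_diff[OF t_var_polynomials[OF i] one_polynomials] .
    then show "at_U l (P_poly l m n k) * (t_var i - 1) \<in> elementary_ideal l k G \<phi> \<inter> polynomials l"
      using torus_dets_lower[OF k E(1) E(2) i] at_U_mult_polynomials by blast
  qed
  have d: "l + 1 - l = 1" by simp
  show "AG l l G \<phi> = {at_U l (P_poly l m n l)}"
    unfolding AG_def
  proof (rule unique, assumption, assumption, rule reduced_groebner_basis_principal[OF l1 monic])
    fix f assume "f \<in> elementary_ideal l l G \<phi> \<inter> polynomials l"
    then show "f \<in> polynomials l \<and> (\<exists>h. f = at_U l (P_poly l m n l) * h)"
      using E(3)[where k = l, unfolded d, OF ideal_over_multiples torus_dets_principal_upper]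
      by (auto simp: dvd_def)
  next
    show "at_U l (P_poly l m n l) \<in> elementary_ideal l l G \<phi> \<inter> polynomials l"
      using torus_dets_principal_lower[OF E(1) E(2)[where k = l, unfolded d]] at_U_polynomials by blast
  qed
qed

theorem corollary4p3:
  fixes l m n :: nat and \<rho> :: real and b :: "complex \<times> complex"
    and \<phi> :: "(real \<Rightarrow> complex \<times> complex) set \<Rightarrow> exponent"
  assumes "1 < l" and "0 < m" and "0 < n" and "coprime m n"
    and tube: "tubular_radius (link_set l (torus_link l n m)) \<rho>"
    and base: "b \<in> link_exterior (link_set l (torus_link l n m)) \<rho>"
    and phi: "meridional_system l (torus_link l n m) \<rho> b \<phi>"
    and known_description:
      "torus_link_presentation l n m (link_group l (torus_link l n m) \<rho> b) \<phi>"
  shows "(\<forall>k. 1 \<le> k \<and> k < l \<longrightarrow>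
            AG l k (link_group l (torus_link l n m) \<rho> b) \<phi> =
              {at_U l (P_poly l m n k) * (t_var i - 1) | i. 1 \<le> i \<and> i \<le> l})
       \<and> AG l l (link_group l (torus_link l n m) \<rho> b) \<phi> = {at_U l (P_poly l m n l)}
       \<and> P_poly l m n l * (U_poly m * U_poly n) = U_poly (m * n) * U_poly 1"
proof -
  have hom: "\<phi> \<in> hom (link_group l (torus_link l n m) \<rho> b) (Z_lattice l)"
    using phi by (simp add: meridional_system_def epi_def)
  have "P_poly l m n l = gcd (A_poly m n) (B_poly m n)" by (simp add: P_poly_def)
  then show ?thesis
    using AG_torus[OF assms(1-4) hom known_description] gcd_AB_identity[OF assms(2-4)] by simp
qed

end
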